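(* Let $G$ be a finite simple $d$-regular graph on $n$ vertices, with $n\geq 5$. (a) If $d\geq 4$ and $G$ does not contain $H_d$ as a subgraph, then there exists an avoidance coupling of two walkers on $G$. (b) If $d=3$ and $G$ does not contain $\widetilde H_3$ as a subgraph, then there exists an avoidance coupling of two walkers on $G$.
   Context: For a finite simple graph $G=(V,E)$ and $v\in V$, write $N(v)=\{u\in V:\{u,v\}\in E\}$ and $\deg(v)=|N(v)|$. A (discrete-time) simple random walk on $G$ is a $V$-valued Markov chain $(X_t)_{t\geq 0}$ (with arbitrary initial law) such that $\mathbb{P}(X_{t+1}=u\mid X_t=v)=1/\deg(v)$ if $u\in N(v)$ and $0$ otherwise. An avoidance coupling (of two walkers) on $G$ is a discrete-time $(V\times V)$-valued process $(A_t,B_t)_{t\geq 0}$ such that: (1) (faithfulness) $(A_t)_{t\geq 0}$ and $(B_t)_{t\geq 0}$ are each simple random walks on $G$, each with respect to its own history; and (2) (avoidance) $B_t\notin\{A_t,A_{t+1}\}$ for all $t\geq 0$. The graph $H_d$ has $d+1$ vertices $a,b,c_1,\dots,c_{d-1}$ and $2d-1$ edges: $\{a,b\}$, and $\{a,c_i\}$, $\{b,c_i\}$ for $1\leq i\leq d-1$. The graph $\widetilde H_3$ has five vertices $a,b,c_1,c_2,c_3$ and seven edges: $\{a,c_i\}$, $\{b,c_i\}$ for $i=1,2,3$, and $\{c_1,c_2\}$. "Contains as a subgraph" means contains an isomorphic copy as a not necessarily induced subgraph. *)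

theory Defs
  imports "HOL-Probability.Probability"
begin

section \<open>Finite simple graphs\<close>

definition simple_graph :: "'a set \<Rightarrow> 'a set set \<Rightarrow> bool" where
  "simple_graph V E \<longleftrightarrow> finite V \<and> (\<forall>e\<in>E. e \<subseteq> V \<and> card e = 2)"

definition nbrs :: "'a set \<Rightarrow> 'a set set \<Rightarrow> 'a \<Rightarrow> 'a set" where
  "nbrs V E v = {u \<in> V. {u, v} \<in> E}"

definition deg :: "'a set \<Rightarrow> 'a set set \<Rightarrow> 'a \<Rightarrow> nat" where
  "deg V E v = card (nbrs V E v)"

definition regular :: "nat \<Rightarrow> 'a set \<Rightarrow> 'a set set \<Rightarrow> bool" where
  "regular d V E \<longleftrightarrow> (\<forall>v\<in>V. deg V E v = d)"

text \<open>Not necessarily induced: only edges have to be preserved.\<close>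

definition contains_subgraph ::
  "'a set \<Rightarrow> 'a set set \<Rightarrow> 'b set \<Rightarrow> 'b set set \<Rightarrow> bool" where
  "contains_subgraph V E V' E' \<longleftrightarrow>
     (\<exists>f. inj_on f V' \<and> f ` V' \<subseteq> V \<and> (\<forall>e\<in>E'. f ` e \<in> E))"

section \<open>The excluded graphs\<close>

datatype hvertex = vA | vB | vC nat

definition H_verts :: "nat \<Rightarrow> hvertex set" where
  "H_verts d = {vA, vB} \<union> vC ` {1..d - 1}"

definition H_edges :: "nat \<Rightarrow> hvertex set set" where
  "H_edges d = {{vA, vB}} \<union> (\<Union>i\<in>{1..d - 1}. {{vA, vC i}, {vB, vC i}})"

definition H3t_verts :: "hvertex set" where
  "H3t_verts = {vA, vB, vC 1, vC 2, vC 3}"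

definition H3t_edges :: "hvertex set set" where
  "H3t_edges = (\<Union>i\<in>{1, 2, 3}. {{vA, vC i}, {vB, vC i}}) \<union> {{vC 1, vC 2}}"

lemma simple_graph_H: "simple_graph (H_verts d) (H_edges d)"
  by (auto simp: simple_graph_def H_verts_def H_edges_def card_insert_if)

lemma simple_graph_H3t: "simple_graph H3t_verts H3t_edges"
  by (auto simp: simple_graph_def H3t_verts_def H3t_edges_def card_insert_if)

section \<open>Avoidance couplings\<close>

text \<open>
  A process is a sequence of discrete random variables on a probability space \<open>M\<close>.
  As usual, conditional probabilities are only prescribed when the conditioning event has
  positive probability.
\<close>

definition markov_chain :: "'w measure \<Rightarrow> 'a set \<Rightarrow> (nat \<Rightarrow> 'w \<Rightarrow> 'a) \<Rightarrow> bool" where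
  "markov_chain M V X \<longleftrightarrow>
     (\<forall>t. X t \<in> M \<rightarrow>\<^sub>M count_space V) \<and>
     (\<forall>t x. \<forall>u\<in>V. \<P>(w in M. \<forall>s\<le>t. X s w = x s) > 0 \<longrightarrow>
        \<P>(w in M. X (Suc t) w = u \<bar> \<forall>s\<le>t. X s w = x s) =
        \<P>(w in M. X (Suc t) w = u \<bar> X t w = x t))"

definition simple_random_walk ::
  "'w measure \<Rightarrow> 'a set \<Rightarrow> 'a set set \<Rightarrow> (nat \<Rightarrow> 'w \<Rightarrow> 'a) \<Rightarrow> bool" where
  "simple_random_walk M V E X \<longleftrightarrow>
     markov_chain M V X \<and>
     (\<forall>t. \<forall>v\<in>V. \<forall>u\<in>V. \<P>(w in M. X t w = v) > 0 \<longrightarrow>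
        \<P>(w in M. X (Suc t) w = u \<bar> X t w = v) =
        (if u \<in> nbrs V E v then 1 / real (deg V E v) else 0))"

definition avoidance_coupling ::
  "'w measure \<Rightarrow> 'a set \<Rightarrow> 'a set set \<Rightarrow> (nat \<Rightarrow> 'w \<Rightarrow> 'a) \<Rightarrow> (nat \<Rightarrow> 'w \<Rightarrow> 'a) \<Rightarrow> bool" where
  "avoidance_coupling M V E A B \<longleftrightarrow>
     prob_space M \<and>
     simple_random_walk M V E A \<and>
     simple_random_walk M V E B \<and>
     (\<forall>w\<in>space M. \<forall>t. B t w \<notin> {A t w, A (Suc t) w})"

text \<open>
  HOL cannot quantify over the type of the sample space. Fixing it to \<open>nat \<Rightarrow> 'a \<times> 'a\<close> loses
  no generality: only the joint law of the pair of processes matters, and this law lives on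
  the space of trajectories (restricted to the trajectories that avoid collisions).
\<close>

definition has_avoidance_coupling :: "'a set \<Rightarrow> 'a set set \<Rightarrow> bool" where
  "has_avoidance_coupling V E \<longleftrightarrow>
     (\<exists>(M :: (nat \<Rightarrow> 'a \<times> 'a) measure) A B. avoidance_coupling M V E A B)"

end

theory Submission
  imports Defs
begin

text \<open>
  Interleave the walks as \<open>A\<^sub>0, B\<^sub>0, A\<^sub>1, B\<^sub>1, \<dots>\<close> and call the result \<open>p\<^sub>0, p\<^sub>1, p\<^sub>2, \<dots>\<close>. The walkers avoid
  each other iff \<open>p\<^sub>n\<^sub>+\<^sub>1 \<noteq> p\<^sub>n\<close> for all \<open>n\<close>, and both are simple random walks as soon as \<open>p\<^sub>n\<^sub>+\<^sub>2\<close> is uniform on the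
  neighbours of \<open>p\<^sub>n\<close> given \<open>p\<^sub>0, \<dots>, p\<^sub>n\<close>, so that \<open>p\<^sub>n\<^sub>+\<^sub>1\<close>, the last move of the other walker, stays
  hidden. It therefore suffices to find a Markov chain on pairs \<open>(p\<^sub>n, \<alpha>\<^sub>n)\<close>, where \<open>\<alpha>\<^sub>n\<close> is the
  conditional law of \<open>p\<^sub>n\<^sub>+\<^sub>1\<close>. A move couples \<open>\<alpha>\<^sub>n\<close> with the uniform distribution on the neighbours
  of \<open>p\<^sub>n\<close> off the diagonal, and the conditional laws of the second component must again admit such a
  coupling. If all degrees are at least 4, one can take for \<open>\<alpha>\<^sub>n\<close> a fair choice between two vertices. For
  cubic graphs one bounds the mass that \<open>\<alpha>\<^sub>n\<close> puts on the neighbours of \<open>p\<^sub>n\<close>, depending on the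
  triangles and 4-cycles nearby.
\<close>

section \<open>Couplings from hidden Markov chains\<close>

text \<open>The process is pushed forward along its trajectory map \<open>h\<close>. The range of
  \<open>h\<close> serves as the new sample space, so that avoidance holds at every point and not
  only almost surely.\<close>

lemma has_avoidance_couplingI:
  fixes M :: "'w measure"
  assumes AC: "avoidance_coupling M V E A B"
  shows "has_avoidance_coupling V E"
proof -
  define h where "h w = (\<lambda>t. (A t w, B t w))" for w
  \<comment> \<open>The largest sigma-algebra that makes \<open>h\<close> measurable: an event about
    trajectories is measurable iff its preimage is.\<close>
  define S where "S = {D. D \<subseteq> h ` space M \<and> h -` D \<inter> space M \<in> sets M}"
  have S: "sigma_algebra (h ` space M) S"
  proof (rule sigma_algebra_iff2[THEN iffD2], intro conjI ballI allI impI)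
    show "S \<subseteq> Pow (h ` space M)" "{} \<in> S"
      by (auto simp: S_def)
    show "h ` space M - D \<in> S" if "D \<in> S" for D
    proof -
      have "h -` (h ` space M - D) \<inter> space M = space M - (h -` D \<inter> space M)"
        by auto
      with that show ?thesis
        by (auto simp: S_def)
    qed
    show "(\<Union>i. D i) \<in> S" if "range D \<subseteq> S" for D :: "nat \<Rightarrow> _"
    proof -
      have "h -` (\<Union>i. D i) \<inter> space M = (\<Union>i. h -` D i \<inter> space M)"
        by auto
      moreover have "\<dots> \<in> sets M"
        using that by (intro sets.countable_UN) (auto simp: S_def)
      ultimately show ?thesis
        using that by (auto simp: S_def)
    qed
  qed
  define N where "N = distr M (sigma (h ` space M) S) h"
  have Spow: "S \<subseteq> Pow (h ` space M)"
    by (auto simp: S_def)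
  have spN: "space N = h ` space M" and seN: "sets N = S"
    using Spow S by (auto simp: N_def sigma_algebra.sigma_sets_eq)
  have h: "h \<in> M \<rightarrow>\<^sub>M sigma (h ` space M) S"
    using Spow by (intro measurable_measure_of) (auto simp: S_def)
  have prob: "prob_space M"
    using AC by (simp add: avoidance_coupling_def)
  have meas: "measure N {w \<in> space N. P w} = measure M {w \<in> space M. P (h w)}" for P
  proof (cases "{w \<in> space N. P w} \<in> sets N")
    case True
    then have "measure N {w \<in> space N. P w} = measure M (h -` {w \<in> space N. P w} \<inter> space M)"
      unfolding N_def by (intro measure_distr[OF h]) auto
    also have "h -` {w \<in> space N. P w} \<inter> space M = {w \<in> space M. P (h w)}"
      by (auto simp: spN)
    finally show ?thesis .
  next
    \<comment> \<open>Both sides are 0 by convention, as \<open>measure\<close> vanishes outside the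
      sigma-algebra.\<close>
    case False
    have "h -` {w \<in> space N. P w} \<inter> space M = {w \<in> space M. P (h w)}"
      by (auto simp: spN)
    then have "{w \<in> space M. P (h w)} \<notin> sets M"
      using False by (auto simp: seN S_def spN)
    with False show ?thesis
      by (simp add: measure_notin_sets)
  qed
  have cond: "\<P>(w in N. P w \<bar> Q w) = \<P>(w in M. P (h w) \<bar> Q (h w))" for P Q
    by (simp add: cond_prob_def meas)
  have transfer: "simple_random_walk N V E Y"
    if X: "simple_random_walk M V E X" and Y: "\<And>t w. Y t (h w) = X t w" for X Y
  proof -
    have "Y t \<in> N \<rightarrow>\<^sub>M count_space V" for t
    proof (rule measurableI)
      have Xt: "X t \<in> M \<rightarrow>\<^sub>M count_space V"
        using X by (simp add: simple_random_walk_def markov_chain_def)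
      show "Y t w \<in> space (count_space V)" if "w \<in> space N" for w
        using that measurable_space[OF Xt] Y by (auto simp: spN)
      fix D assume "D \<in> sets (count_space V)"
      moreover have "h -` (Y t -` D \<inter> space N) \<inter> space M = X t -` D \<inter> space M"
        by (auto simp: spN Y[symmetric])
      ultimately show "Y t -` D \<inter> space N \<in> sets N"
        using measurable_sets[OF Xt, of D] by (auto simp: seN S_def spN)
    qed
    with X show ?thesis
      unfolding simple_random_walk_def markov_chain_def meas cond Y by simp
  qed
  have "avoidance_coupling N V E (\<lambda>t w. fst (w t)) (\<lambda>t w. snd (w t))"
    unfolding avoidance_coupling_def
  proof (intro conjI)
    show "prob_space N"
      unfolding N_def by (rule prob_space.prob_space_distr[OF prob h])
    show "simple_random_walk N V E (\<lambda>t w. fst (w t))"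
      using AC by (intro transfer[of A]) (auto simp: avoidance_coupling_def h_def)
    show "simple_random_walk N V E (\<lambda>t w. snd (w t))"
      using AC by (intro transfer[of B]) (auto simp: avoidance_coupling_def h_def)
    show "\<forall>w\<in>space N. \<forall>t. snd (w t) \<notin> {fst (w t), fst (w (Suc t))}"
      using AC by (auto simp: avoidance_coupling_def h_def spN)
  qed
  then show ?thesis
    unfolding has_avoidance_coupling_def by blast
qed

text \<open>Both kinds of conditioning event, the full history and the present state, lead to the
  same kernel; this gives the Markov property and the transition law at once. The product form of
  \<open>step\<close> avoids dividing by the probability of \<open>H\<close>.\<close>

lemma simple_random_walkI:
  assumes "prob_space M"
    and X: "\<And>t. X t \<in> M \<rightarrow>\<^sub>M count_space V"
    and step: "\<And>t x u H. \<lbrakk>u \<in> V; x t \<in> V;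
        H = {w \<in> space M. \<forall>s\<le>t. X s w = x s} \<or> H = {w \<in> space M. X t w = x t}\<rbrakk> \<Longrightarrow>
      measure M {w \<in> H. X (Suc t) w = u} =
        (if u \<in> nbrs V E (x t) then 1 / deg V E (x t) else 0) * measure M H"
  shows "simple_random_walk M V E X"
proof -
  interpret prob_space M by fact
  let ?k = "\<lambda>v u. if u \<in> nbrs V E v then 1 / real (deg V E v) else 0"
  have one: "\<P>(w in M. X (Suc t) w = u \<bar> X t w = v) = ?k v u"
    if "u \<in> V" "v \<in> V" "\<P>(w in M. X t w = v) > 0" for t u v
  proof -
    have "{w \<in> space M. X (Suc t) w = u \<and> X t w = v} = {w \<in> {w \<in> space M. X t w = v}. X (Suc t) w = u}"
      by auto
    with step[where x = "\<lambda>_. v" and t = t, OF that(1,2), of "{w \<in> space M. X t w = v}"] that(3)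
    show ?thesis
      unfolding cond_prob_def by simp
  qed
  have two: "\<P>(w in M. X (Suc t) w = u \<bar> \<forall>s\<le>t. X s w = y s) = ?k (y t) u"
    if "u \<in> V" "y t \<in> V" "\<P>(w in M. \<forall>s\<le>t. X s w = y s) > 0" for t u y
  proof -
    have "{w \<in> space M. X (Suc t) w = u \<and> (\<forall>s\<le>t. X s w = y s)}
        = {w \<in> {w \<in> space M. \<forall>s\<le>t. X s w = y s}. X (Suc t) w = u}"
      by auto
    with step[where x = y and t = t, OF that(1,2), of "{w \<in> space M. \<forall>s\<le>t. X s w = y s}"] that(3)
    show ?thesis
      unfolding cond_prob_def by simp
  qed
  \<comment> \<open>An event of positive probability is nonempty, so \<open>x t\<close> is a value
    taken by \<open>X t\<close>.\<close>
  have inV: "x t \<in> V" and pos: "\<P>(w in M. X t w = x t) > 0"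
    if p: "\<P>(w in M. \<forall>s\<le>t. X s w = x s) > 0" for t x
  proof -
    have "{w \<in> space M. \<forall>s\<le>t. X s w = x s} \<noteq> {}"
      using p by (metis measure_empty less_irrefl)
    then obtain w where "w \<in> space M" "X t w = x t"
      by auto
    then show "x t \<in> V"
      using measurable_space[OF X, of w t] by simp
    have "{w \<in> space M. X t w = x t} = X t -` ({x t} \<inter> V) \<inter> space M"
      using measurable_space[OF X] by auto
    then have "{w \<in> space M. X t w = x t} \<in> events"
      using measurable_sets[OF X, of "{x t} \<inter> V"] by auto
    then have "\<P>(w in M. \<forall>s\<le>t. X s w = x s) \<le> \<P>(w in M. X t w = x t)"
      by (intro finite_measure_mono) auto
    with p show "\<P>(w in M. X t w = x t) > 0"
      by simp
  qed
  have "\<P>(w in M. X (Suc t) w = u \<bar> \<forall>s\<le>t. X s w = x s)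
      = \<P>(w in M. X (Suc t) w = u \<bar> X t w = x t)"
    if "u \<in> V" "\<P>(w in M. \<forall>s\<le>t. X s w = x s) > 0" for t x u
    using one[OF that(1) inV[OF that(2)] pos[OF that(2)]]
      two[OF that(1) inV[OF that(2)] that(2)] by simp
  with one X show ?thesis
    unfolding simple_random_walk_def markov_chain_def by blast
qed

section \<open>Path measure of a Markov chain with discrete kernels\<close>

locale markov_path =
  fixes K :: "'s \<Rightarrow> 's pmf" and s0 :: 's
begin

text \<open>The law of coordinate \<open>n\<close> given a path of earlier coordinates, in the shape
  that \<open>Ionescu_Tulcea\<close> expects.\<close>

definition step_measure :: "nat \<Rightarrow> (nat \<Rightarrow> 's) \<Rightarrow> 's measure" where
  "step_measure n w = measure_pmf (case n of 0 \<Rightarrow> return_pmf s0 | Suc m \<Rightarrow> K (w m))"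

lemma step_measure_restrict: "step_measure n (restrict w {0..<n}) = step_measure n w"
  by (simp add: step_measure_def split: nat.split)

text \<open>With the discrete sigma-algebra every map out of the state space is measurable. This
  matters because the states will themselves contain probability laws.\<close>

sublocale Ionescu_Tulcea step_measure "\<lambda>_. count_space UNIV"
proof (rule Ionescu_Tulcea.intro)
  show "step_measure n \<in> measurable (PiM {0..<n} (\<lambda>_. count_space UNIV)) (subprob_algebra (count_space UNIV))" for n
  proof (cases n)
    case 0
    then show ?thesis
      by (simp add: step_measure_def[abs_def] measure_pmf_in_subprob_algebra)
  next
    case (Suc m)
    have "(\<lambda>w. measure_pmf (K (w m))) \<in> measurable (PiM {0..<n} (\<lambda>_. count_space UNIV)) (subprob_algebra (count_space UNIV))"
      using Suc by (intro measurable_compose[OF measurable_component_singleton]) (auto simp: measure_pmf_in_subprob_algebra)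
    then show ?thesis
      using Suc by (simp add: step_measure_def[abs_def])
  qed
  show "prob_space (step_measure n w)" for n w
    by (simp add: step_measure_def measure_pmf.prob_space_axioms)
qed

abbreviation \<Omega> where "\<Omega> \<equiv> PF.lim"

abbreviation paths :: "nat \<Rightarrow> (nat \<Rightarrow> 's) measure" where
  "paths n \<equiv> PiM {0..<n} (\<lambda>_. count_space UNIV)"

lemma prob_space_path: "prob_space \<Omega>"
proof -
  have "prob_space (distr \<Omega> (paths 0) (\<lambda>w. restrict w {0..<0}))"
    using PF.prob_space_P[of "{0..<0}"] by (simp add: distr_lim)
  then show ?thesis
    by (rule prob_space_distrD[rotated])
      (rule measurable_restrict, simp add: measurable_cong_sets[OF PF.sets_lim refl])
qed

lemma space_path [simp]: "space \<Omega> = UNIV"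
  by (simp add: space_PiM)

lemma measurable_restrict_path [measurable]: "(\<lambda>w. restrict w {0..<n}) \<in> measurable \<Omega> (paths n)"
  by (rule measurable_restrict) (simp add: measurable_cong_sets[OF PF.sets_lim refl])

lemma measurable_coord [measurable]: "(\<lambda>w. w n) \<in> measurable \<Omega> (count_space UNIV)"
  by (simp add: measurable_cong_sets[OF PF.sets_lim refl])

text \<open>Identifies the first \<open>n\<close> coordinates under the projective limit with the
  iterated kernel \<open>C 0 n\<close>, for which a recursion in \<open>n\<close> is
  available.\<close>

lemma nn_integral_path:
  assumes f: "f \<in> borel_measurable (paths n)"
  shows "(\<integral>\<^sup>+w. f (restrict w {0..<n}) \<partial>\<Omega>) = (\<integral>\<^sup>+w. f w \<partial>C 0 n (\<lambda>_. undefined))"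
proof -
  have "CI {0..<n} = C 0 n (\<lambda>_. undefined)"
  proof (rule measure_eqI)
    show "sets (CI {0..<n}) = sets (C 0 n (\<lambda>_. undefined))"
      by (simp add: CI_def sets_C space_PiM)
    show "emeasure (CI {0..<n}) A = emeasure (C 0 n (\<lambda>_. undefined)) A" if "A \<in> sets (CI {0..<n})" for A
      using that emeasure_CI[of "{0..<n}" n A] sets.sets_into_space[of A "paths n"]
      by (auto simp: CI_def prod_emb_id space_PiM)
  qed
  moreover have "(\<integral>\<^sup>+w. f (restrict w {0..<n}) \<partial>\<Omega>) = (\<integral>\<^sup>+w. f w \<partial>distr \<Omega> (paths n) (\<lambda>w. restrict w {0..<n}))"
    using f by (simp add: nn_integral_distr)
  ultimately show ?thesis
    by (simp add: distr_lim)
qed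

lemma nn_integral_path_Suc:
  assumes f[measurable]: "f \<in> borel_measurable (paths (Suc n))"
  shows "(\<integral>\<^sup>+w. f (restrict w {0..<Suc n}) \<partial>\<Omega>) =
    (\<integral>\<^sup>+w. (\<integral>\<^sup>+s. f ((restrict w {0..<n})(n := s)) \<partial>step_measure n w) \<partial>\<Omega>)"
proof -
  have u: "(\<lambda>_. undefined) \<in> space (paths 0)"
    by (simp add: space_PiM)
  have "(\<integral>\<^sup>+w. f (restrict w {0..<Suc n}) \<partial>\<Omega>) = (\<integral>\<^sup>+w. (\<integral>\<^sup>+x. f x \<partial>eP n w) \<partial>C 0 n (\<lambda>_. undefined))"
    using measurable_eP[of n] measurable_C[of 0 n]
    by (subst nn_integral_path[OF f], simp,
        subst nn_integral_bind[where B = "paths (Suc n)"])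
      (auto simp: measurable_cong_sets[OF sets_C[OF u] refl])
  also have "\<dots> = (\<integral>\<^sup>+w. (\<integral>\<^sup>+x. f x \<partial>eP n (restrict w {0..<n})) \<partial>\<Omega>)"
    by (rule nn_integral_path[symmetric]) measurable
  also have "\<dots> = (\<integral>\<^sup>+w. (\<integral>\<^sup>+s. f ((restrict w {0..<n})(n := s)) \<partial>step_measure n (restrict w {0..<n})) \<partial>\<Omega>)"
    by (intro nn_integral_cong nn_integral_eP) (auto simp: space_PiM)
  also have "\<dots> = (\<integral>\<^sup>+w. (\<integral>\<^sup>+s. f ((restrict w {0..<n})(n := s)) \<partial>step_measure n w) \<partial>\<Omega>)"
    by (simp only: step_measure_restrict)
  finally show ?thesis .
qed

text \<open>The Markov property in integrated form: the tower rule applied to an event of the past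
  times a function of the next state.\<close>

lemma nn_integral_path_step:
  fixes h :: "'s \<Rightarrow> ennreal"
  assumes E[measurable]: "E \<in> sets (paths n)"
  shows "(\<integral>\<^sup>+w. indicator E (restrict w {0..<n}) * h (w n) \<partial>\<Omega>) =
    (\<integral>\<^sup>+w. indicator E (restrict w {0..<n}) * (\<integral>\<^sup>+s. h s \<partial>step_measure n w) \<partial>\<Omega>)"
proof -
  let ?f = "\<lambda>w. indicator E (restrict w {0..<n}) * h (w n)"
  have [measurable]: "(\<lambda>w. restrict w {0..<n}) \<in> measurable (paths (Suc n)) (paths n)"
    by (rule measurable_restrict_subset) auto
  have [measurable]: "(\<lambda>w. h (w n)) \<in> borel_measurable (paths (Suc n))"
    by (rule measurable_compose[OF measurable_component_singleton]) auto
  have r: "restrict (restrict w {0..<Suc n}) {0..<n} = restrict w {0..<n}"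
    "restrict ((restrict w {0..<n})(n := s)) {0..<n} = restrict w {0..<n}" for w :: "nat \<Rightarrow> 's" and s
    by (auto simp: restrict_def fun_eq_iff)
  have "(\<integral>\<^sup>+w. ?f w \<partial>\<Omega>) = (\<integral>\<^sup>+w. ?f (restrict w {0..<Suc n}) \<partial>\<Omega>)"
    unfolding r by simp
  also have "\<dots> = (\<integral>\<^sup>+w. (\<integral>\<^sup>+s. ?f ((restrict w {0..<n})(n := s)) \<partial>step_measure n w) \<partial>\<Omega>)"
    by (rule nn_integral_path_Suc) measurable
  also have "\<dots> = (\<integral>\<^sup>+w. indicator E (restrict w {0..<n}) * (\<integral>\<^sup>+s. h s \<partial>step_measure n w) \<partial>\<Omega>)"
    unfolding r by (simp add: step_measure_def nn_integral_cmult)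
  finally show ?thesis .
qed

text \<open>The one-step property is used twice, first with \<open>E\<close> read as an event
  \<open>E'\<close> about one more coordinate, then with \<open>E\<close> itself.\<close>

lemma nn_integral_path_two_steps:
  fixes h :: "'s \<Rightarrow> ennreal"
  assumes E[measurable]: "E \<in> sets (paths (Suc n))"
  shows "(\<integral>\<^sup>+w. indicator E (restrict w {0..<Suc n}) * h (w (Suc (Suc n))) \<partial>\<Omega>) =
    (\<integral>\<^sup>+w. indicator E (restrict w {0..<Suc n}) * (\<integral>\<^sup>+s. h s \<partial>bind_pmf (K (w n)) K) \<partial>\<Omega>)"
proof -
  define E' where "E' = (\<lambda>w. restrict w {0..<Suc n}) -` E \<inter> space (paths (Suc (Suc n)))"
  have "(\<lambda>w. restrict w {0..<Suc n}) \<in> measurable (paths (Suc (Suc n))) (paths (Suc n))"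
    by (rule measurable_restrict_subset) auto
  then have E': "E' \<in> sets (paths (Suc (Suc n)))"
    unfolding E'_def using E by (rule measurable_sets)
  have "restrict (restrict w {0..<Suc (Suc n)}) {0..<Suc n} = restrict w {0..<Suc n}" for w :: "nat \<Rightarrow> 's"
    by (auto simp: restrict_def fun_eq_iff)
  moreover have "restrict w {0..<Suc (Suc n)} \<in> space (paths (Suc (Suc n)))" for w
    by (simp add: space_PiM)
  ultimately have ind: "indicator E (restrict w {0..<Suc n}) = (indicator E' (restrict w {0..<Suc (Suc n)}) :: ennreal)" for w
    unfolding E'_def by (simp add: indicator_def)
  have "(\<integral>\<^sup>+w. indicator E (restrict w {0..<Suc n}) * h (w (Suc (Suc n))) \<partial>\<Omega>) =
      (\<integral>\<^sup>+w. indicator E (restrict w {0..<Suc n}) * (\<integral>\<^sup>+s. h s \<partial>K (w (Suc n))) \<partial>\<Omega>)"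
    unfolding ind by (subst nn_integral_path_step[OF E']) (simp add: step_measure_def)
  also have "\<dots> = (\<integral>\<^sup>+w. indicator E (restrict w {0..<Suc n}) * (\<integral>\<^sup>+s. h s \<partial>bind_pmf (K (w n)) K) \<partial>\<Omega>)"
    by (subst nn_integral_path_step[OF E]) (simp add: step_measure_def)
  finally show ?thesis .
qed

text \<open>The probability of such a jump is an integral of \<open>K s\<close>-masses of
  \<open>D\<close> over \<open>s\<close> in \<open>B\<close>, all of which are 0.\<close>

lemma AE_step:
  assumes B: "\<And>s. s \<in> B \<Longrightarrow> set_pmf (K s) \<inter> D = {}"
  shows "AE w in \<Omega>. w n \<in> B \<longrightarrow> w (Suc n) \<notin> D"
proof -
  define E where "E = (\<lambda>w. w n) -` B \<inter> space (paths (Suc n))"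
  have "(\<lambda>w. w n) \<in> measurable (paths (Suc n)) (count_space UNIV)"
    by (rule measurable_component_singleton) auto
  then have E[measurable]: "E \<in> sets (paths (Suc n))"
    unfolding E_def by (rule measurable_sets) auto
  have E_iff: "restrict w {0..<Suc n} \<in> E \<longleftrightarrow> w n \<in> B" for w
    by (simp add: E_def space_PiM)
  have zero: "w n \<in> B \<Longrightarrow> emeasure (K (w n)) D = 0" for w
    using B by (simp add: measure_pmf.emeasure_eq_measure measure_pmf_zero_iff)
  have "(\<integral>\<^sup>+w. indicator E (restrict w {0..<Suc n}) * indicator D (w (Suc n)) \<partial>\<Omega>) = (\<integral>\<^sup>+w. 0 \<partial>\<Omega>)"
    by (subst nn_integral_path_step[OF E], rule nn_integral_cong)
      (simp add: step_measure_def E_iff zero indicator_def)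
  then have "(\<integral>\<^sup>+w. indicator E (restrict w {0..<Suc n}) * indicator D (w (Suc n)) \<partial>\<Omega>) = 0"
    by simp
  moreover have "(\<lambda>w. indicator E (restrict w {0..<Suc n}) * indicator D (w (Suc n)) :: ennreal) \<in> borel_measurable \<Omega>"
    by (intro borel_measurable_times_ennreal measurable_compose[OF measurable_coord]
        measurable_compose[OF measurable_restrict_path]) auto
  ultimately have "AE w in \<Omega>. indicator E (restrict w {0..<Suc n}) * indicator D (w (Suc n)) = (0::ennreal)"
    by (subst (asm) nn_integral_0_iff_AE) auto
  then show ?thesis
    by (rule AE_mp) (auto simp: indicator_def E_iff)
qed

lemma AE_start: "AE w in \<Omega>. w 0 = s0"
proof -
  let ?E = "space (paths 0)"
  have E: "restrict w {0..<0} \<in> ?E" for w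
    by (simp add: space_PiM restrict_def)
  have "(\<integral>\<^sup>+w. indicator (- {s0}) (w 0) \<partial>\<Omega>) = (0::ennreal)"
    using nn_integral_path_step[of ?E 0 "indicator (- {s0})"] E
    by (simp add: step_measure_def indicator_def)
  moreover have "(\<lambda>w. indicator (- {s0}) (w 0) :: ennreal) \<in> borel_measurable \<Omega>"
    by (intro measurable_compose[OF measurable_coord]) auto
  ultimately have "AE w in \<Omega>. indicator (- {s0}) (w 0) = (0::ennreal)"
    by (subst (asm) nn_integral_0_iff_AE) auto
  then show ?thesis
    by (rule AE_mp) (auto simp: indicator_def)
qed

lemma AE_coord:
  assumes s0: "s0 \<in> G" and closed: "\<And>s. s \<in> G \<Longrightarrow> set_pmf (K s) \<subseteq> G"
  shows "AE w in \<Omega>. w n \<in> G"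
proof (induction n)
  case 0
  then show ?case
    using AE_start by (rule AE_mp[OF _ AE_I2]) (use s0 in auto)
next
  case (Suc n)
  have "AE w in \<Omega>. w n \<in> G \<longrightarrow> w (Suc n) \<notin> - G"
    by (rule AE_step) (use closed in auto)
  with Suc show ?case
    by eventually_elim auto
qed

end

section \<open>From a Markov chain to an avoidance coupling\<close>

context markov_path
begin

text \<open>One walker reads the even coordinates, the other the odd ones, so avoidance compares
  exactly consecutive coordinates. The history of a walker is a function of all coordinates up to
  \<open>n\<close>, and already given these the position two steps later is uniform on the
  neighbours.\<close>

lemma avoidance_coupling_path:
  fixes pos :: "'s \<Rightarrow> 'a"
  assumes fin: "finite V"
    and s0: "s0 \<in> G" and closed: "\<And>s. s \<in> G \<Longrightarrow> set_pmf (K s) \<subseteq> G"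
    and posV: "\<And>s. s \<in> G \<Longrightarrow> pos s \<in> V"
    and avoid: "\<And>s s'. s \<in> G \<Longrightarrow> s' \<in> set_pmf (K s) \<Longrightarrow> pos s' \<noteq> pos s"
    and nbrs: "\<And>v. v \<in> V \<Longrightarrow> nbrs V E v \<noteq> {}"
    and two_steps: "\<And>s. s \<in> G \<Longrightarrow> map_pmf pos (bind_pmf (K s) K) = pmf_of_set (nbrs V E (pos s))"
  shows "\<exists>M :: (nat \<Rightarrow> 's) measure.
    avoidance_coupling M V E (\<lambda>t w. pos (w (2 * t))) (\<lambda>t w. pos (w (2 * t + 1)))"
proof -
  interpret P: prob_space \<Omega>
    by (rule prob_space_path)
  note space_PiM [simp]
  have pos[measurable]: "(\<lambda>w. pos (w n)) \<in> measurable \<Omega> (count_space UNIV)" for n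
    by (rule measurable_compose[OF measurable_coord]) simp
  have ev[measurable]: "{w. pos (w n) \<in> D} \<in> sets \<Omega>" for n D
    using measurable_sets[OF pos, of D n] by (simp add: vimage_def)
  \<comment> \<open>Avoidance and values in \<open>V\<close> are demanded at every sample point,
    hence the restriction to \<open>S\<close>. Finiteness of \<open>V\<close> makes \<open>S\<close>
    a countable combination of coordinate events.\<close>
  define S where "S = (\<Inter>n. {w. pos (w n) \<in> V}) - (\<Union>n. \<Union>v\<in>V. {w. pos (w n) \<in> {v}} \<inter> {w. pos (w (Suc n)) \<in> {v}})"
  have S_sets: "S \<in> sets \<Omega>"
    unfolding S_def
  proof (rule sets.Diff)
    have UNIV: "UNIV \<in> sets \<Omega>"
      using sets.top[of \<Omega>] by simp
    show "(\<Inter>n. {w. pos (w n) \<in> V}) \<in> sets \<Omega>"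
      by (intro sets.countable_INT'' UNIV ev) simp
    show "(\<Union>n. \<Union>v\<in>V. {w. pos (w n) \<in> {v}} \<inter> {w. pos (w (Suc n)) \<in> {v}}) \<in> sets \<Omega>"
      by (intro sets.countable_UN'' sets.finite_UN fin sets.Int ev) simp
  qed
  have AE_G: "AE w in \<Omega>. w n \<in> G" for n
    by (rule AE_coord[OF s0 closed])
  have AE_S: "AE w in \<Omega>. w \<in> S"
  proof -
    have "AE w in \<Omega>. pos (w n) \<in> V" for n
      using AE_G[of n] by eventually_elim (rule posV)
    moreover have "AE w in \<Omega>. pos (w n) = v \<longrightarrow> pos (w (Suc n)) \<noteq> v" for n v
    proof -
      have "AE w in \<Omega>. w n \<in> {s \<in> G. pos s = v} \<longrightarrow> w (Suc n) \<notin> {s. pos s = v}"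
        by (rule AE_step) (use avoid in auto)
      with AE_G[of n] show ?thesis
        by eventually_elim auto
    qed
    ultimately have "AE w in \<Omega>. \<forall>n. pos (w n) \<in> V" "AE w in \<Omega>. \<forall>n. \<forall>v\<in>V. pos (w n) = v \<longrightarrow> pos (w (Suc n)) \<noteq> v"
      unfolding AE_all_countable by (intro allI AE_finite_allI[OF fin]; blast)+
    then show ?thesis
      by eventually_elim (auto simp: S_def)
  qed
  define M where "M = restrict_space \<Omega> S"
  have spM: "space M = S"
    by (simp add: M_def space_restrict_space)
  have prob_S: "emeasure \<Omega> S = 1"
    using P.prob_Collect_eq_1[of "\<lambda>w. w \<in> S"] S_sets AE_S by (simp add: P.emeasure_eq_measure)
  then have M: "prob_space M"
    unfolding M_def using S_sets by (intro prob_space_restrict_space) auto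
  have measM: "measure M {w \<in> S. Q w} = measure \<Omega> {w. Q w}" if "{w. Q w} \<in> sets \<Omega>" for Q
  proof -
    have "measure M {w \<in> S. Q w} = measure \<Omega> {w \<in> S. Q w}"
      unfolding M_def using S_sets by (intro measure_restrict_space) auto
    also have "\<dots> = measure \<Omega> {w. Q w}"
    proof (rule P.finite_measure_eq_AE)
      show "AE w in \<Omega>. (w \<in> {w \<in> S. Q w}) = (w \<in> {w. Q w})"
        using AE_S by eventually_elim simp
      have "{w \<in> S. Q w} = S \<inter> {w. Q w}"
        by auto
      then show "{w \<in> S. Q w} \<in> sets \<Omega>"
        using S_sets that by auto
    qed fact
    finally show ?thesis .
  qed
  have walk: "simple_random_walk M V E (\<lambda>t w. pos (w (2 * t + e)))" for e
  proof (rule simple_random_walkI[OF M])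
    show "(\<lambda>w. pos (w (2 * t + e))) \<in> M \<rightarrow>\<^sub>M count_space V" for t
    proof (rule measurableI)
      show "pos (w (2 * t + e)) \<in> space (count_space V)" if "w \<in> space M" for w
        using that by (auto simp: spM S_def)
      show "(\<lambda>w. pos (w (2 * t + e))) -` D \<inter> space M \<in> sets M" for D
        using measurable_sets[OF pos, of D "2 * t + e"] S_sets
        by (auto simp: M_def sets_restrict_space space_restrict_space)
    qed
  next
    fix t x u H
    assume u: "u \<in> V" and x: "x t \<in> V"
      and H: "H = {w \<in> space M. \<forall>s\<le>t. pos (w (2 * s + e)) = x s} \<or> H = {w \<in> space M. pos (w (2 * t + e)) = x t}"
    let ?n = "2 * t + e"
    let ?k = "if u \<in> nbrs V E (x t) then 1 / real (deg V E (x t)) else 0"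
    \<comment> \<open>\<open>I\<close> is \<open>{..t}\<close> for the full history and
      \<open>{t}\<close> for the present, so both conditioning events are treated together.\<close>
    obtain I where I: "finite I" "I \<subseteq> {..t}" "t \<in> I"
      and HI: "H = {w \<in> S. \<forall>s\<in>I. pos (w (2 * s + e)) = x s}"
      using H
    proof
      assume "H = {w \<in> space M. \<forall>s\<le>t. pos (w (2 * s + e)) = x s}"
      then show thesis
        by (intro that[of "{..t}"]) (auto simp: spM)
    next
      assume "H = {w \<in> space M. pos (w (2 * t + e)) = x t}"
      then show thesis
        by (intro that[of "{t}"]) (auto simp: spM)
    qed
    define F where "F = {w. \<forall>s\<in>I. pos (w (2 * s + e)) = x s}"
    have F_INT: "F = (\<Inter>s\<in>I. {w. pos (w (2 * s + e)) \<in> {x s}})"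
      by (auto simp: F_def)
    have F_sets: "F \<in> sets \<Omega>"
      unfolding F_INT using I by (intro sets.finite_INT ev) auto
    \<comment> \<open>\<open>F\<close> read as an event about the first \<open>2 * t + e + 1\<close>
      coordinates.\<close>
    define E' where "E' = (\<Inter>s\<in>I. (\<lambda>w. pos (w (2 * s + e))) -` {x s} \<inter> space (paths (Suc ?n)))"
    have "(\<lambda>w. pos (w (2 * s + e))) \<in> measurable (paths (Suc ?n)) (count_space UNIV)" if "s \<in> I" for s
      using that I by (intro measurable_compose[OF measurable_component_singleton]) auto
    then have E': "E' \<in> sets (paths (Suc ?n))"
      unfolding E'_def using I by (intro sets.finite_INT measurable_sets) auto
    have ind: "indicator E' (restrict w {0..<Suc ?n}) = (indicator F w :: ennreal)" for w
    proof -
      have "restrict w {0..<Suc ?n} \<in> space (paths (Suc ?n))"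
        by simp
      moreover have "restrict w {0..<Suc ?n} (2 * s + e) = w (2 * s + e)" if "s \<in> I" for s
        using that I by auto
      ultimately have "restrict w {0..<Suc ?n} \<in> E' \<longleftrightarrow> w \<in> F"
        using I unfolding E'_def F_def by (auto simp del: restrict_apply)
      then show ?thesis
        by (simp add: indicator_def)
    qed
    have Fu: "{w \<in> F. pos (w (Suc (Suc ?n))) = u} \<in> sets \<Omega>"
      using sets.Int[OF F_sets ev[of "Suc (Suc ?n)" "{u}"]] by (simp add: Int_def)
    have key: "emeasure \<Omega> {w \<in> F. pos (w (Suc (Suc ?n))) = u} = ennreal ?k * emeasure \<Omega> F"
    proof -
      have "emeasure \<Omega> {w \<in> F. pos (w (Suc (Suc ?n))) = u} =
          (\<integral>\<^sup>+w. indicator {w \<in> F. pos (w (Suc (Suc ?n))) = u} w \<partial>\<Omega>)"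
        using Fu by simp
      also have "\<dots> = (\<integral>\<^sup>+w. indicator E' (restrict w {0..<Suc ?n}) * indicator (pos -` {u}) (w (Suc (Suc ?n))) \<partial>\<Omega>)"
        unfolding ind by (intro nn_integral_cong) (auto simp: indicator_def)
      also have "\<dots> = (\<integral>\<^sup>+w. indicator F w * (\<integral>\<^sup>+s. indicator (pos -` {u}) s \<partial>bind_pmf (K (w ?n)) K) \<partial>\<Omega>)"
        by (subst nn_integral_path_two_steps[OF E']) (simp only: ind)
      \<comment> \<open>On \<open>F\<close> the state at time \<open>2 * t + e\<close> has position
        \<open>x t\<close>, so \<open>two_steps\<close> turns the inner integral into the constant
        \<open>?k\<close>.\<close>
      also have "\<dots> = (\<integral>\<^sup>+w. ennreal ?k * indicator F w \<partial>\<Omega>)"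
      proof (rule nn_integral_cong_AE)
        have *: "indicator F w * (\<integral>\<^sup>+s. indicator (pos -` {u}) s \<partial>bind_pmf (K (w ?n)) K) = ennreal ?k * indicator F w"
          if "w ?n \<in> G" for w
        proof (cases "w \<in> F")
          case True
          then have "pos (w ?n) = x t"
            using I by (auto simp: F_def)
          have fn: "finite (nbrs V E (x t))"
            using fin by (simp add: nbrs_def)
          have "(\<integral>\<^sup>+s. indicator (pos -` {u}) s \<partial>bind_pmf (K (w ?n)) K) =
              emeasure (bind_pmf (K (w ?n)) K) (pos -` {u})"
            by (rule nn_integral_indicator) simp
          also have "\<dots> = emeasure (map_pmf pos (bind_pmf (K (w ?n)) K)) {u}"
            by (rule emeasure_map_pmf[symmetric])
          also have "\<dots> = ennreal ?k"
            unfolding two_steps[OF that] \<open>pos (w ?n) = x t\<close>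
            using nbrs[OF x] fn by (simp add: emeasure_pmf_single deg_def)
          finally show ?thesis
            using True by simp
        qed simp
        show "AE w in \<Omega>. indicator F w * (\<integral>\<^sup>+s. indicator (pos -` {u}) s \<partial>bind_pmf (K (w ?n)) K) =
            ennreal ?k * indicator F w"
          using AE_G[of ?n] by eventually_elim (rule *)
      qed
      also have "\<dots> = ennreal ?k * emeasure \<Omega> F"
        using F_sets by (simp only: nn_integral_cmult_indicator)
      finally show ?thesis .
    qed
    have "measure \<Omega> {w \<in> F. pos (w (Suc (Suc ?n))) = u} = ?k * measure \<Omega> F"
      using key by (simp add: P.emeasure_eq_measure flip: ennreal_mult')
    moreover have "measure M H = measure \<Omega> F"
      unfolding HI F_def using measM[of "\<lambda>w. w \<in> F"] F_sets by (simp add: F_def)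
    moreover have "measure M {w \<in> H. pos (w (2 * Suc t + e)) = u} = measure \<Omega> {w \<in> F. pos (w (Suc (Suc ?n))) = u}"
      using measM[of "\<lambda>w. w \<in> F \<and> pos (w (Suc (Suc ?n))) = u"] Fu by (simp add: HI F_def conj_assoc)
    ultimately show "measure M {w \<in> H. pos (w (2 * Suc t + e)) = u} = ?k * measure M H"
      by simp
  qed
  have "avoidance_coupling M V E (\<lambda>t w. pos (w (2 * t))) (\<lambda>t w. pos (w (2 * t + 1)))"
    unfolding avoidance_coupling_def
  proof (intro conjI ballI allI)
    show "simple_random_walk M V E (\<lambda>t w. pos (w (2 * t)))"
      using walk[of 0] by simp
    fix w t
    assume "w \<in> space M"
    then have "pos (w (Suc n)) \<noteq> pos (w n)" for n
      by (auto simp: spM S_def)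
    from this[of "2 * t"] this[of "Suc (2 * t)"]
    show "pos (w (2 * t + 1)) \<notin> {pos (w (2 * t)), pos (w (2 * Suc t))}"
      by auto
  qed (use M walk[of 1] in auto)
  then show ?thesis
    by blast
qed

end

text \<open>\<open>Q\<close> is the law of the next state. Its first marginal lets the next position
  obey the announced law \<open>\<alpha>\<close>; averaging the laws that it announces in turn gives
  the uniform move from \<open>x\<close>. One choice of \<open>Q\<close> per state is a
  kernel.\<close>

theorem has_avoidance_coupling_alternating:
  fixes V :: "'a set" and G :: "('a \<times> 'a pmf) set"
  assumes fin: "finite V" and nbrs: "\<And>v. v \<in> V \<Longrightarrow> nbrs V E v \<noteq> {}"
    and G: "G \<noteq> {}"
    and step: "\<And>x \<alpha>. (x, \<alpha>) \<in> G \<Longrightarrow> x \<in> V \<and> x \<notin> set_pmf \<alpha> \<and>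
      (\<exists>Q. map_pmf fst Q = \<alpha> \<and> bind_pmf Q snd = pmf_of_set (nbrs V E x) \<and> set_pmf Q \<subseteq> G)"
  shows "has_avoidance_coupling V E"
proof -
  obtain s0 where s0: "s0 \<in> G"
    using G by auto
  have "\<forall>s\<in>G. \<exists>Q. map_pmf fst Q = snd s \<and> bind_pmf Q snd = pmf_of_set (nbrs V E (fst s)) \<and> set_pmf Q \<subseteq> G"
    using step by auto
  then obtain K where K: "\<And>s. s \<in> G \<Longrightarrow> map_pmf fst (K s) = snd s"
    "\<And>s. s \<in> G \<Longrightarrow> bind_pmf (K s) snd = pmf_of_set (nbrs V E (fst s))"
    "\<And>s. s \<in> G \<Longrightarrow> set_pmf (K s) \<subseteq> G"
    by metis
  interpret markov_path K s0 .
  have "\<exists>M :: (nat \<Rightarrow> 'a \<times> 'a pmf) measure.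
    avoidance_coupling M V E (\<lambda>t w. fst (w (2 * t))) (\<lambda>t w. fst (w (2 * t + 1)))"
  proof (rule avoidance_coupling_path[OF fin s0 K(3)])
    show "fst s \<in> V" if "s \<in> G" for s
      using step that by (metis prod.collapse)
    show "fst s' \<noteq> fst s" if "s \<in> G" "s' \<in> set_pmf (K s)" for s s'
    proof -
      have "fst s' \<in> set_pmf (snd s)"
        using K(1)[OF that(1), symmetric] that(2) by simp
      moreover have "fst s \<notin> set_pmf (snd s)"
        using step that by (metis prod.collapse)
      ultimately show ?thesis
        by auto
    qed
    show "map_pmf fst (bind_pmf (K s) K) = pmf_of_set (nbrs V E (fst s))" if "s \<in> G" for s
    proof -
      have "map_pmf fst (bind_pmf (K s) K) = bind_pmf (K s) (\<lambda>s'. map_pmf fst (K s'))"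
        by (simp add: map_bind_pmf)
      also have "\<dots> = bind_pmf (K s) snd"
        using K(1) K(3)[OF that] by (intro bind_pmf_cong refl) blast
      finally show ?thesis
        using K(2) that by simp
    qed
  qed (use nbrs in auto)
  then show ?thesis
    by (blast intro: has_avoidance_couplingI)
qed

section \<open>Minimum degree four\<close>

lemma pmf_bind_pmf_of_set_2:
  assumes "x \<noteq> y"
  shows "pmf (bind_pmf (pmf_of_set {x, y}) g) u = (pmf (g x) u + pmf (g y) u) / 2"
  using assms by (simp add: pmf_bind integral_pmf_of_set)

lemma pmf_of_set_2:
  assumes "x \<noteq> y"
  shows "pmf (pmf_of_set {x, y}) u = (if u = x \<or> u = y then 1 / 2 else 0)"
  using assms by (simp add: indicator_def)

text \<open>The pairs of a \<open>k\<close>-subset and one of its points are counted in two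
  ways.\<close>

lemma bind_pmf_of_subsets:
  assumes fin: "finite A" and k: "0 < k" "k \<le> card A"
  shows "bind_pmf (pmf_of_set {W. W \<subseteq> A \<and> card W = k}) pmf_of_set = pmf_of_set A"
proof (rule pmf_eqI)
  fix u
  let ?S = "{W. W \<subseteq> A \<and> card W = k}"
  have A: "A \<noteq> {}"
    using k by auto
  have card_S: "card ?S = card A choose k"
    by (rule n_subsets[OF fin])
  then have S: "finite ?S" "?S \<noteq> {}"
    using fin obtain_subset_with_card_n[OF k(2)] by (auto intro: finite_subset[of _ "Pow A"])
  have "pmf (bind_pmf (pmf_of_set ?S) pmf_of_set) u = (\<Sum>W\<in>?S. pmf (pmf_of_set W) u) / card ?S"
    using S by (simp add: pmf_bind integral_pmf_of_set)
  also have "(\<Sum>W\<in>?S. pmf (pmf_of_set W) u) = (\<Sum>W\<in>?S. if u \<in> W then 1 / k else 0)"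
  proof (rule sum.cong)
    fix W assume "W \<in> ?S"
    then have "finite W" "W \<noteq> {}" "card W = k"
      using fin k by (auto intro: finite_subset)
    then show "pmf (pmf_of_set W) u = (if u \<in> W then 1 / k else 0)"
      by (simp add: indicator_def)
  qed simp
  also have "\<dots> = card {W \<in> ?S. u \<in> W} / k"
    using S by (simp add: sum.If_cases Int_def)
  also have "card {W \<in> ?S. u \<in> W} = (if u \<in> A then (card A - 1) choose (k - 1) else 0)"
  proof (cases "u \<in> A")
    case True
    have "bij_betw (insert u) {W. W \<subseteq> A - {u} \<and> card W = k - 1} {W \<in> ?S. u \<in> W}"
    proof (rule bij_betw_byWitness[where f' = "\<lambda>W. W - {u}"])
      show "insert u ` {W. W \<subseteq> A - {u} \<and> card W = k - 1} \<subseteq> {W \<in> ?S. u \<in> W}"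
      proof safe
        fix W assume W: "W \<subseteq> A - {u}" "card W = k - 1"
        then have "finite W" "u \<notin> W"
          using fin by (auto intro: finite_subset)
        with W k show "card (insert u W) = k"
          by simp
      qed (use True in auto)
      show "(\<lambda>W. W - {u}) ` {W \<in> ?S. u \<in> W} \<subseteq> {W. W \<subseteq> A - {u} \<and> card W = k - 1}"
        by auto
    qed auto
    then have "card {W \<in> ?S. u \<in> W} = card {W. W \<subseteq> A - {u} \<and> card W = k - 1}"
      by (rule bij_betw_same_card[symmetric])
    also have "\<dots> = card (A - {u}) choose (k - 1)"
      using fin by (intro n_subsets) auto
    finally show ?thesis
      using True by simp
  next
    case False
    then have "{W \<in> ?S. u \<in> W} = {}"
      by auto
    then show ?thesis
      using False by (simp only: card.empty if_False)
  qed
  also have "real (if u \<in> A then (card A - 1) choose (k - 1) else 0) / k / card ?S = pmf (pmf_of_set A) u"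
  proof -
    have "k * (card A choose k) = card A * ((card A - 1) choose (k - 1))"
      using k by (intro times_binomial_minus1_eq) simp
    then have *: "real k * real (card A choose k) = real (card A) * real ((card A - 1) choose (k - 1))"
      by (metis of_nat_mult)
    have "real ((card A - 1) choose (k - 1)) / (real k * real (card A choose k)) = 1 / real (card A)"
      unfolding * using k by (simp add: field_simps)
    then show ?thesis
      using fin A by (simp add: card_S)
  qed
  finally show "pmf (bind_pmf (pmf_of_set ?S) pmf_of_set) u = pmf (pmf_of_set A) u" .
qed

text \<open>
  Given that four vertices remain for the next move, \<open>p\<close> is left out if the other walker is at \<open>a\<close>,
  and \<open>q\<close> if it is at \<open>b\<close>.
\<close>

lemma split_four:
  assumes W: "card W = 4" and ab: "a \<noteq> b"
  obtains p q r r' where "W = {p, q, r, r'}" "distinct [p, q, r, r']"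
    "a \<notin> {q, r, r'}" "b \<notin> {p, r, r'}"
proof -
  have fin: "finite W"
    using W by (metis card.infinite zero_neq_numeral)
  have nonempty: "\<exists>y. y \<in> W - D" if "finite D" "card D \<le> 3" for D
    using W that card_mono[of D W] by force
  obtain p where p: "p \<in> W" "a \<in> W \<Longrightarrow> p = a" "p \<noteq> b"
    using nonempty[of "{b}"] ab by (cases "a \<in> W") auto
  obtain q where q: "q \<in> W" "b \<in> W \<Longrightarrow> q = b" "q \<noteq> a" "q \<noteq> p"
  proof (cases "b \<in> W")
    case False
    have "card {a, p} \<le> 3"
      by (simp add: card_insert_if)
    with nonempty[of "{a, p}"] False show thesis
      by (auto intro: that)
  qed (use ab p that in auto)
  have "card (W - {p, q}) = 2"
    using W fin p q by (simp add: card_Diff_subset)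
  then obtain r r' where r: "W - {p, q} = {r, r'}" "r \<noteq> r'"
    by (auto simp: card_2_iff)
  show thesis
  proof (rule that)
    show "W = {p, q, r, r'}" "distinct [p, q, r, r']"
      using p q r by auto
    show "a \<notin> {q, r, r'}" "b \<notin> {p, r, r'}"
      using p q r by auto
  qed
qed

text \<open>Every vertex gets 1/2 * 1/2: \<open>p\<close> and \<open>q\<close> each require one
  value of \<open>v\<close>, \<open>r\<close> and \<open>r'\<close> one value of \<open>y\<close>,
  and then one of the two entries of the pair.\<close>

lemma fair_pair_four:
  assumes d: "distinct [p, q, r, r']" and ab: "a \<noteq> b"
  shows "bind_pmf (pmf_of_set {a, b}) (\<lambda>v. bind_pmf (pmf_of_set {r, r'}) (\<lambda>y.
      pmf_of_set {if v = a then q else p, y})) = pmf_of_set {p, q, r, r'}"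
proof (rule pmf_eqI)
  fix u
  have "card {p, q, r, r'} = 4"
    using d by simp
  then have "pmf (pmf_of_set {p, q, r, r'}) u = (if u = p \<or> u = q \<or> u = r \<or> u = r' then 1 / 4 else 0)"
    by (simp add: indicator_def)
  moreover have "p \<noteq> q" "p \<noteq> r" "p \<noteq> r'" "q \<noteq> r" "q \<noteq> r'" "r \<noteq> r'"
    using d by auto
  ultimately show "pmf (bind_pmf (pmf_of_set {a, b}) (\<lambda>v. bind_pmf (pmf_of_set {r, r'}) (\<lambda>y.
      pmf_of_set {if v = a then q else p, y}))) u = pmf (pmf_of_set {p, q, r, r'}) u"
    using ab by (simp add: pmf_bind_pmf_of_set_2 pmf_of_set_2)
qed

text \<open>A uniform 4-subset \<open>W\<close> of \<open>A\<close> is drawn first, which reduces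
  the claim to four vertices. For \<open>v = a\<close> the pair leaves out \<open>p\<close>, the
  only vertex of \<open>W\<close> that can equal \<open>a\<close>, and likewise \<open>q\<close> for
  \<open>v = b\<close>; so the pair never contains \<open>v\<close>.\<close>

lemma fair_pair_step:
  fixes A :: "'a set"
  assumes fin: "finite A" and card: "4 \<le> card A" and ab: "a \<noteq> b"
  obtains Q where "map_pmf fst Q = pmf_of_set {a, b}" "bind_pmf Q snd = pmf_of_set A"
    "set_pmf Q \<subseteq> {(v, pmf_of_set {y, y'}) |v y y'. v \<in> {a, b} \<and> {y, y'} \<subseteq> A - {v} \<and> y \<noteq> y'}"
proof -
  define S where "S = {W. W \<subseteq> A \<and> card W = 4}"
  have S: "finite S" "S \<noteq> {}"
    unfolding S_def using fin obtain_subset_with_card_n[OF card] by (auto intro: finite_subset[of _ "Pow A"])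
  have "\<forall>W\<in>S. \<exists>p q r r'. W = {p, q, r, r'} \<and> distinct [p, q, r, r'] \<and> a \<notin> {q, r, r'} \<and> b \<notin> {p, r, r'}"
    by (intro ballI, rule split_four[OF _ ab], unfold S_def) blast+
  then obtain p q r r' where W: "\<And>W. W \<in> S \<Longrightarrow> W = {p W, q W, r W, r' W} \<and> distinct [p W, q W, r W, r' W] \<and>
      a \<notin> {q W, r W, r' W} \<and> b \<notin> {p W, r W, r' W}"
    by metis
  define other where "other W v = (if v = a then q W else p W)" for W v
  define Q where "Q = bind_pmf (pmf_of_set S) (\<lambda>W. bind_pmf (pmf_of_set {a, b}) (\<lambda>v.
    bind_pmf (pmf_of_set {r W, r' W}) (\<lambda>y. return_pmf (v, pmf_of_set {other W v, y}))))"
  show thesis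
  proof
    show "map_pmf fst Q = pmf_of_set {a, b}"
      by (simp add: Q_def map_bind_pmf bind_return_pmf')
    have "bind_pmf Q snd = bind_pmf (pmf_of_set S) (\<lambda>W. bind_pmf (pmf_of_set {a, b}) (\<lambda>v.
        bind_pmf (pmf_of_set {r W, r' W}) (\<lambda>y. pmf_of_set {other W v, y})))"
      by (simp add: Q_def bind_assoc_pmf bind_return_pmf)
    also have "\<dots> = bind_pmf (pmf_of_set S) pmf_of_set"
    proof (rule bind_pmf_cong[OF refl])
      fix W assume "W \<in> set_pmf (pmf_of_set S)"
      then have "W \<in> S"
        using S by simp
      show "bind_pmf (pmf_of_set {a, b}) (\<lambda>v. bind_pmf (pmf_of_set {r W, r' W}) (\<lambda>y. pmf_of_set {other W v, y})) = pmf_of_set W"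
        using fair_pair_four[of "p W" "q W" "r W" "r' W" a b] W[OF \<open>W \<in> S\<close>] ab
        unfolding other_def by metis
    qed
    also have "\<dots> = pmf_of_set A"
      unfolding S_def using fin card by (intro bind_pmf_of_subsets) auto
    finally show "bind_pmf Q snd = pmf_of_set A" .
    show "set_pmf Q \<subseteq> {(v, pmf_of_set {y, y'}) |v y y'. v \<in> {a, b} \<and> {y, y'} \<subseteq> A - {v} \<and> y \<noteq> y'}"
    proof
      fix s assume "s \<in> set_pmf Q"
      then obtain W v y where s: "s = (v, pmf_of_set {other W v, y})" "W \<in> S" "v \<in> {a, b}" "y \<in> {r W, r' W}"
        using S by (auto simp: Q_def)
      moreover have "{p W, q W, r W, r' W} \<subseteq> A"
        using s W[OF s(2)] by (metis (no_types, lifting) S_def mem_Collect_eq)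
      ultimately show "s \<in> {(v, pmf_of_set {y, y'}) |v y y'. v \<in> {a, b} \<and> {y, y'} \<subseteq> A - {v} \<and> y \<noteq> y'}"
        using W[OF s(2), THEN conjunct2] ab by (auto simp: other_def)
    qed
  qed
qed

lemma nbrs_subset: "nbrs V E v \<subseteq> V"
  by (auto simp: nbrs_def)

lemma nbrs_sym: "simple_graph V E \<Longrightarrow> u \<in> nbrs V E v \<longleftrightarrow> v \<in> nbrs V E u"
  by (auto simp: nbrs_def simple_graph_def insert_commute)

lemma nbrs_irrefl: "simple_graph V E \<Longrightarrow> v \<notin> nbrs V E v"
  by (fastforce simp: nbrs_def simple_graph_def)

text \<open>The invariant set consists of a position together with a fair choice between two other
  vertices. By \<open>fair_pair_step\<close>, four neighbours suffice to announce a new choice of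
  this kind.\<close>

theorem has_avoidance_coupling_min_degree_4:
  assumes G: "simple_graph V E" and V: "V \<noteq> {}" and deg: "\<And>v. v \<in> V \<Longrightarrow> 4 \<le> deg V E v"
  shows "has_avoidance_coupling V E"
proof (rule has_avoidance_coupling_alternating)
  let ?G = "{(x, pmf_of_set {a, b}) |x a b. x \<in> V \<and> {a, b} \<subseteq> V - {x} \<and> a \<noteq> b}"
  show fin: "finite V"
    using G by (simp add: simple_graph_def)
  show ne: "nbrs V E v \<noteq> {}" if "v \<in> V" for v
    using deg[OF that] by (auto simp: deg_def)
  show "?G \<noteq> {}"
  proof -
    obtain x where x: "x \<in> V"
      using V by auto
    have "2 \<le> card (nbrs V E x)"
      using deg[OF x] by (simp add: deg_def)
    then obtain W where W: "W \<subseteq> nbrs V E x" "card W = 2"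
      using obtain_subset_with_card_n by metis
    then obtain a b where "W = {a, b}" "a \<noteq> b"
      by (auto simp: card_2_iff)
    then have "{a, b} \<subseteq> V - {x}" "a \<noteq> b"
      using W(1) nbrs_irrefl[OF G] nbrs_subset[of V E x] by auto
    with x show ?thesis
      by blast
  qed
  fix x \<alpha> assume "(x, \<alpha>) \<in> ?G"
  then obtain a b where x: "x \<in> V" and ab: "{a, b} \<subseteq> V - {x}" "a \<noteq> b" and \<alpha>: "\<alpha> = pmf_of_set {a, b}"
    by auto
  have "finite (nbrs V E x)"
    using fin nbrs_subset by (rule rev_finite_subset)
  moreover have "4 \<le> card (nbrs V E x)"
    using deg[OF x] by (simp add: deg_def)
  ultimately obtain Q where Q: "map_pmf fst Q = pmf_of_set {a, b}" "bind_pmf Q snd = pmf_of_set (nbrs V E x)"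
    "set_pmf Q \<subseteq> {(v, pmf_of_set {y, y'}) |v y y'. v \<in> {a, b} \<and> {y, y'} \<subseteq> nbrs V E x - {v} \<and> y \<noteq> y'}"
    using ab(2) by (rule fair_pair_step)
  have "{(v, pmf_of_set {y, y'}) |v y y'. v \<in> {a, b} \<and> {y, y'} \<subseteq> nbrs V E x - {v} \<and> y \<noteq> y'} \<subseteq> ?G"
    using ab nbrs_subset[of V E x] by blast
  with Q(3) have "set_pmf Q \<subseteq> ?G"
    by (rule subset_trans)
  then show "x \<in> V \<and> x \<notin> set_pmf \<alpha> \<and>
      (\<exists>Q. map_pmf fst Q = \<alpha> \<and> bind_pmf Q snd = pmf_of_set (nbrs V E x) \<and> set_pmf Q \<subseteq> ?G)"
    using Q(1,2) x ab by (auto simp: \<alpha>)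
qed

section \<open>Cubic graphs\<close>

text \<open>\<open>F\<close> is a joint law with marginals \<open>\<alpha>\<close> and the uniform
  law on \<open>N\<close>; \<open>f v\<close> is its conditional law given \<open>v\<close>.\<close>

lemma pmf_transport:
  fixes \<alpha> :: "'a pmf" and F :: "'a \<Rightarrow> 'a \<Rightarrow> real"
  assumes S: "finite S" "set_pmf \<alpha> \<subseteq> S" and N: "finite N" "N \<noteq> {}"
    and nonneg: "\<And>v u. v \<in> S \<Longrightarrow> u \<in> N \<Longrightarrow> 0 \<le> F v u"
    and row: "\<And>v. v \<in> S \<Longrightarrow> (\<Sum>u\<in>N. F v u) = pmf \<alpha> v"
    and col: "\<And>u. u \<in> N \<Longrightarrow> (\<Sum>v\<in>S. F v u) = 1 / card N"
  obtains f where "bind_pmf \<alpha> f = pmf_of_set N"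
    "\<And>v. v \<in> set_pmf \<alpha> \<Longrightarrow> set_pmf (f v) \<subseteq> N"
    "\<And>v u. v \<in> set_pmf \<alpha> \<Longrightarrow> u \<in> N \<Longrightarrow> pmf (f v) u = F v u / pmf \<alpha> v"
proof -
  define g where "g v u = (if u \<in> N then F v u / pmf \<alpha> v else 0)" for v u
  define f where "f v = embed_pmf (g v)" for v
  have pmf_f: "pmf (f v) u = g v u" if v: "v \<in> set_pmf \<alpha>" for v u
    unfolding f_def
  proof (rule pmf_embed_pmf)
    show "0 \<le> g v u" for u
      using v S nonneg by (auto simp: g_def)
    have "(\<integral>\<^sup>+u. ennreal (g v u) \<partial>count_space UNIV) = (\<integral>\<^sup>+u. ennreal (g v u) \<partial>count_space N)"
      by (rule nn_integral_count_space_eq) (auto simp: g_def)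
    also have "\<dots> = (\<Sum>u\<in>N. ennreal (g v u))"
      using N(1) by (rule nn_integral_count_space_finite)
    also have "\<dots> = ennreal (\<Sum>u\<in>N. g v u)"
      using v S nonneg by (intro sum_ennreal) (auto simp: g_def)
    also have "(\<Sum>u\<in>N. g v u) = (\<Sum>u\<in>N. F v u) / pmf \<alpha> v"
      by (simp add: g_def sum_divide_distrib)
    also have "\<dots> = 1"
      using v S row by (auto simp: set_pmf_iff)
    finally show "(\<integral>\<^sup>+u. ennreal (g v u) \<partial>count_space UNIV) = 1"
      by simp
  qed
  show thesis
  proof
    show "pmf (f v) u = F v u / pmf \<alpha> v" if "v \<in> set_pmf \<alpha>" "u \<in> N" for v u
      using that by (simp add: pmf_f g_def)
    show "set_pmf (f v) \<subseteq> N" if "v \<in> set_pmf \<alpha>" for v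
      using that by (auto simp: set_pmf_iff pmf_f g_def split: if_splits)
    show "bind_pmf \<alpha> f = pmf_of_set N"
    proof (rule pmf_eqI)
      fix u
      have "pmf (bind_pmf \<alpha> f) u = (\<Sum>v\<in>S. pmf (f v) u * pmf \<alpha> v)"
        unfolding pmf_bind using S by (intro integral_measure_pmf_real) auto
      also have "\<dots> = (\<Sum>v\<in>S. if u \<in> N then F v u else 0)"
      proof (rule sum.cong[OF refl])
        fix v assume v: "v \<in> S"
        show "pmf (f v) u * pmf \<alpha> v = (if u \<in> N then F v u else 0)"
        proof (cases "v \<in> set_pmf \<alpha>")
          case True
          then show ?thesis
            by (simp add: pmf_f g_def set_pmf_iff)
        next
          \<comment> \<open>A row of mass 0 has nonnegative entries with sum 0, so it vanishes and
            the arbitrary value of \<open>f v\<close> does no harm.\<close>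
          case False
          then have "(\<Sum>u\<in>N. F v u) = 0"
            using row[OF v] by (simp add: set_pmf_iff)
          then have "u \<in> N \<Longrightarrow> F v u = 0"
            using N nonneg[OF v] by (subst (asm) sum_nonneg_eq_0_iff) auto
          then show ?thesis
            using False by (simp add: set_pmf_iff)
        qed
      qed
      also have "\<dots> = pmf (pmf_of_set N) u"
        using N col by (cases "u \<in> N") auto
      finally show "pmf (bind_pmf \<alpha> f) u = pmf (pmf_of_set N) u" .
    qed
  qed
qed

text \<open>The graph is given by its neighbourhoods. \<open>no_H3t\<close> excludes the forbidden
  subgraph: \<open>a\<close> and \<open>b\<close> share three neighbours, and the edge between
  \<open>c\<close> and \<open>c'\<close> is the additional one.\<close>

locale cubic =
  fixes V :: "'a set" and N :: "'a \<Rightarrow> 'a set"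
  assumes finite_V: "finite V" and nbr_V: "N v \<subseteq> V"
    and sym: "u \<in> N v \<longleftrightarrow> v \<in> N u" and irrefl: "v \<notin> N v"
    and card_nbr: "v \<in> V \<Longrightarrow> card (N v) = 3"
    and no_H3t: "\<lbrakk>a \<noteq> b; distinct [c, c', c'']; {c, c', c''} \<subseteq> N a \<inter> N b\<rbrakk> \<Longrightarrow> c' \<notin> N c"
begin

lemma finite_nbr: "finite (N v)"
  using finite_V nbr_V finite_subset by blast

lemma nbr_eq:
  assumes "distinct [a, b, c]" "a \<in> N v" "b \<in> N v" "c \<in> N v"
  shows "N v = {a, b, c}"
proof -
  have "v \<in> V"
    using assms(2) sym nbr_V by blast
  then have "card {a, b, c} = card (N v)"
    using assms(1) by (simp add: card_nbr)
  with assms show ?thesis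
    using card_subset_eq[OF finite_nbr, of "{a, b, c}" v] by auto
qed

lemma nbr_eq':
  assumes "distinct [a, b, c]" "v \<in> N a" "v \<in> N b" "v \<in> N c"
  shows "N v = {a, b, c}"
  using assms sym by (intro nbr_eq) blast+

lemma nbr_ne: "u \<in> N v \<Longrightarrow> u \<noteq> v"
  using irrefl by auto

text \<open>At a vertex of degree 3 this says that its component is a complete graph on four
  vertices.\<close>

definition K4_at :: "'a \<Rightarrow> bool" where
  "K4_at x \<longleftrightarrow> (\<forall>u\<in>N x. \<forall>v\<in>N x. u \<noteq> v \<longrightarrow> u \<in> N v)"

text \<open>
  One walker is at \<open>x\<close> and about to move; the other one has just left \<open>z\<close> for an unrevealed
  vertex with law \<open>\<alpha>\<close>. The bounds \<open>cap z x c\<close> on \<open>pmf \<alpha> c\<close> were found as a family that reproduces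
  itself from one move to the next. On a component \<open>K\<^sub>4\<close> there is none, so \<open>good\<close> has to exclude
  that both walkers live there; this is where at least five vertices are needed.
\<close>

definition cap :: "'a \<Rightarrow> 'a \<Rightarrow> 'a \<Rightarrow> real" where
  "cap z x c =
    (if \<exists>u\<in>N z - {x}. u \<in> N c \<and> u \<notin> N x then 1 / 3
     else if z \<notin> N x \<or> N z - {x} \<subseteq> N x then 1 / 2 else 2 / 3)"

definition good :: "'a \<Rightarrow> 'a \<Rightarrow> 'a pmf \<Rightarrow> bool" where
  "good z x \<alpha> \<longleftrightarrow> z \<in> V \<and> x \<in> V \<and> z \<noteq> x \<and> \<not> (z \<in> N x \<and> K4_at x) \<and>
     set_pmf \<alpha> \<subseteq> N z - {x} \<and> (\<forall>c\<in>N z \<inter> N x. pmf \<alpha> c \<le> cap z x c)"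

text \<open>
  \<open>F v u\<close> is the joint probability that the unrevealed vertex is \<open>v\<close> and that the walker at \<open>x\<close>
  moves to \<open>u\<close>.
\<close>

definition flow :: "'a \<Rightarrow> 'a \<Rightarrow> 'a pmf \<Rightarrow> ('a \<Rightarrow> 'a \<Rightarrow> real) \<Rightarrow> bool" where
  "flow z x \<alpha> F \<longleftrightarrow>
     (\<forall>v\<in>N z - {x}. \<forall>u\<in>N x. 0 \<le> F v u) \<and>
     (\<forall>v\<in>N z - {x}. (\<Sum>u\<in>N x. F v u) = pmf \<alpha> v) \<and>
     (\<forall>u\<in>N x. (\<Sum>v\<in>N z - {x}. F v u) = 1 / 3) \<and>
     (\<forall>v\<in>(N z - {x}) \<inter> N x. F v v = 0) \<and>
     (\<forall>v\<in>N z - {x}. \<forall>u\<in>N x \<inter> N v. F v u \<le> cap x v u * pmf \<alpha> v)"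

section \<open>The bounds, and the passage from flows to hidden laws\<close>

lemma cap_bounds: "1 / 3 \<le> cap z x c" "cap z x c \<le> 2 / 3"
  "z \<notin> N x \<Longrightarrow> cap z x c \<le> 1 / 2"
  by (auto simp: cap_def)

lemma cap_third: "u \<in> N z \<Longrightarrow> u \<noteq> x \<Longrightarrow> u \<in> N c \<Longrightarrow> u \<notin> N x \<Longrightarrow> cap z x c = 1 / 3"
  by (auto simp: cap_def)

lemma cap_half: "(\<And>u. u \<in> N z \<Longrightarrow> u \<noteq> x \<Longrightarrow> u \<in> N c \<Longrightarrow> u \<in> N x) \<Longrightarrow> 1 / 2 \<le> cap z x c"
  by (auto simp: cap_def)

lemma good_cap: "good z x \<alpha> \<Longrightarrow> c \<in> N z \<Longrightarrow> c \<in> N x \<Longrightarrow> pmf \<alpha> c \<le> cap z x c"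
  by (auto simp: good_def)

lemma good_sum: "good z x \<alpha> \<Longrightarrow> (\<Sum>v\<in>N z - {x}. pmf \<alpha> v) = 1"
  using finite_nbr by (intro sum_pmf_eq_1) (auto simp: good_def)

text \<open>\<open>x\<close> and \<open>z\<close> are both neighbours of \<open>v\<close>, hence
  adjacent, and \<open>x\<close> lies in the same complete graph as \<open>v\<close>. Read
  backwards, the exclusion in \<open>good\<close> is inherited by the next state.\<close>

lemma K4_at_step:
  assumes "v \<in> N z" "x \<in> N v" "x \<noteq> z" "K4_at v"
  shows "z \<in> N x \<and> K4_at x"
proof -
  have z: "z \<in> N v" and v: "v \<in> N x"
    using assms sym by auto
  then have zx: "z \<in> N x"
    using assms by (auto simp: K4_at_def)
  have xV: "x \<in> V"
    using assms nbr_V by auto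
  have "insert v (N v - {x}) \<subseteq> N x"
    using assms v by (auto simp: K4_at_def)
  moreover have "card (insert v (N v - {x})) = card (N x)"
  proof -
    have "v \<in> V"
      using assms(1) nbr_V by auto
    then have "card (N v - {x}) = 2"
      using assms(2) by (simp add: card_nbr finite_nbr)
    then show ?thesis
      using card_nbr[OF xV] irrefl[of v] finite_nbr by simp
  qed
  ultimately have "N x = insert v (N v - {x})"
    by (rule card_subset_eq[OF finite_nbr, symmetric])
  with assms zx show ?thesis
    using sym by (auto simp: K4_at_def)
qed

text \<open>Dividing row \<open>v\<close> by \<open>pmf \<alpha> v\<close> gives the conditional law
  \<open>f v\<close>. The zero diagonal becomes avoidance and the last clause of \<open>flow\<close>
  the new bounds, with \<open>x\<close> now as the vertex that is being left.\<close>

lemma flow_step: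
  assumes g: "good z x \<alpha>" and F: "flow z x \<alpha> F"
  obtains f where "bind_pmf \<alpha> f = pmf_of_set (N x)"
    "\<And>v. v \<in> set_pmf \<alpha> \<Longrightarrow> good x v (f v)"
proof -
  have x: "x \<in> V" and z: "z \<in> V" "z \<noteq> x" and set: "set_pmf \<alpha> \<subseteq> N z - {x}"
    using g by (auto simp: good_def)
  have "card (N x) = 3"
    using x by (rule card_nbr)
  then have "N x \<noteq> {}"
    by auto
  obtain f where f: "bind_pmf \<alpha> f = pmf_of_set (N x)"
    "\<And>v. v \<in> set_pmf \<alpha> \<Longrightarrow> set_pmf (f v) \<subseteq> N x"
    "\<And>v u. v \<in> set_pmf \<alpha> \<Longrightarrow> u \<in> N x \<Longrightarrow> pmf (f v) u = F v u / pmf \<alpha> v"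
    using F \<open>card (N x) = 3\<close> finite_nbr
    by (elim pmf_transport[OF _ set finite_nbr \<open>N x \<noteq> {}\<close>, where F = F, rotated -1])
      (auto simp: flow_def)
  have "good x v (f v)" if v: "v \<in> set_pmf \<alpha>" for v
    unfolding good_def
  proof (intro conjI ballI)
    have vS: "v \<in> N z - {x}"
      using v set by auto
    have pos: "pmf \<alpha> v > 0"
      using v by (simp add: pmf_positive)
    show "x \<in> V" "v \<in> V" "x \<noteq> v"
      using x vS nbr_V by auto
    show "\<not> (x \<in> N v \<and> K4_at v)"
      using K4_at_step[of v z x] g vS by (auto simp: good_def)
    show "set_pmf (f v) \<subseteq> N x - {v}"
    proof -
      have "v \<in> N x \<Longrightarrow> pmf (f v) v = 0"
        using f(3)[OF v] F vS by (auto simp: flow_def)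
      then show ?thesis
        using f(2)[OF v] by (auto simp: set_pmf_iff)
    qed
    show "pmf (f v) u \<le> cap x v u" if u: "u \<in> N x \<inter> N v" for u
    proof -
      have "F v u \<le> cap x v u * pmf \<alpha> v"
        using F u vS by (auto simp: flow_def)
      then have "F v u / pmf \<alpha> v \<le> cap x v u"
        using pos by (simp add: divide_le_eq)
      then show ?thesis
        using f(3)[OF v] u by simp
    qed
  qed
  with f(1) show thesis
    by (rule that)
qed

section \<open>Flows according to the number of common neighbours\<close>

text \<open>The product law works: the diagonal condition is empty, and all conditional
  probabilities are 1/3, the least value of \<open>cap\<close>.\<close>

lemma flow_disjoint:
  assumes g: "good z x \<alpha>" and C: "N z \<inter> N x = {}"
  shows "flow z x \<alpha> (\<lambda>v u. pmf \<alpha> v / 3)"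
proof -
  have "card (N x) = 3"
    using g card_nbr by (auto simp: good_def)
  moreover have "pmf \<alpha> v / 3 \<le> cap x v u * pmf \<alpha> v" for u v
    using mult_right_mono[OF cap_bounds(1), of "pmf \<alpha> v" x v u] by simp
  ultimately show ?thesis
    using C good_sum[OF g] by (auto simp: flow_def simp flip: sum_divide_distrib)
qed

text \<open>
  The row of \<open>c\<close> is taken proportional to \<open>(0, k, 1 - k)\<close> and all other rows proportional to a common
  vector \<open>h\<close>, which the column sums then determine.
\<close>

lemma flow_one_common_aux:
  assumes g: "good z x \<alpha>" and C: "N z \<inter> N x = {c}" and Nx: "N x = {c, a, b}" "distinct [c, a, b]"
    and k: "1 / 3 \<le> k" "k \<le> 2 / 3" "pmf \<alpha> c * k \<le> 1 / 3" "pmf \<alpha> c * (1 - k) \<le> 1 / 3"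
    and ka: "a \<in> N c \<Longrightarrow> k \<le> cap x c a" and kb: "b \<in> N c \<Longrightarrow> 1 - k \<le> cap x c b"
  shows "\<exists>F. flow z x \<alpha> F"
proof -
  let ?s = "pmf \<alpha> c"
  \<comment> \<open>What column \<open>u\<close> still lacks after the row of \<open>c\<close>,
    divided by the remaining mass \<open>1 - ?s\<close>.\<close>
  define h where "h u = (if u = c then 1 / 3 else if u = a then 1 / 3 - ?s * k else 1 / 3 - ?s * (1 - k)) / (1 - ?s)" for u
  define F where "F v u = (if v = c then ?s * (if u = c then 0 else if u = a then k else 1 - k)
    else pmf \<alpha> v * h u)" for v u
  have c: "c \<in> N z" "c \<in> N x"
    using C by auto
  have cS: "c \<in> N z - {x}"
    using c nbr_ne by auto
  have zx: "z \<noteq> x" "z \<in> V" "x \<in> V"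
    using g by (auto simp: good_def)
  have scap: "?s \<le> cap z x c"
    using good_cap[OF g c] .
  then have s: "?s \<le> 2 / 3"
    using cap_bounds(2)[of z x c] by simp
  have s0: "?s \<ge> 0"
    by simp
  have h0: "0 \<le> h u" for u
    using k s by (auto simp: h_def)
  have hc: "h c = 1 / (3 * (1 - ?s))" and ha: "h a = (1 / 3 - ?s * k) / (1 - ?s)"
    and hb: "h b = (1 / 3 - ?s * (1 - k)) / (1 - ?s)"
    using Nx by (auto simp: h_def)
  have hsum: "h c + h a + h b = 1"
  proof -
    have "h c + h a + h b = (1 / 3 + (1 / 3 - ?s * k) + (1 / 3 - ?s * (1 - k))) / (1 - ?s)"
      unfolding hc ha hb add_divide_distrib by simp
    also have "1 / 3 + (1 / 3 - ?s * k) + (1 / 3 - ?s * (1 - k)) = 1 - ?s"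
      by (simp add: algebra_simps)
    finally show ?thesis
      using s by simp
  qed
  have "?s * (1 / 3) \<le> ?s * k" "?s * (1 / 3) \<le> ?s * (1 - k)"
    using k s0 by (intro mult_left_mono; simp)+
  \<comment> \<open>Since \<open>k\<close> and \<open>1 - k\<close> are at least 1/3, the row of
    \<open>c\<close> takes at least a proportional share of these two columns.\<close>
  then have hab: "h a \<le> 1 / 3" "h b \<le> 1 / 3"
    unfolding ha hb using s by (simp_all add: field_simps)
  have rest: "(\<Sum>v\<in>N z - {x} - {c}. pmf \<alpha> v) = 1 - ?s"
    using good_sum[OF g] cS finite_nbr by (simp add: sum.remove[of _ c])
  have colsum: "(\<Sum>v\<in>N z - {x}. F v u) = F c u + (1 - ?s) * h u" for u
  proof -
    have "(\<Sum>v\<in>N z - {x}. F v u) = F c u + (\<Sum>v\<in>N z - {x} - {c}. F v u)"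
      using cS finite_nbr by (simp add: sum.remove[of _ c])
    also have "(\<Sum>v\<in>N z - {x} - {c}. F v u) = (\<Sum>v\<in>N z - {x} - {c}. pmf \<alpha> v * h u)"
      by (intro sum.cong) (auto simp: F_def)
    finally show ?thesis
      by (simp add: rest flip: sum_distrib_right)
  qed
  have "(1 - ?s) * h c = 1 / 3" "(1 - ?s) * h a = 1 / 3 - ?s * k" "(1 - ?s) * h b = 1 / 3 - ?s * (1 - k)"
    using s by (simp_all add: hc ha hb)
  then have col: "(\<Sum>v\<in>N z - {x}. F v u) = 1 / 3" if "u \<in> N x" for u
    unfolding colsum using that Nx by (auto simp: F_def)
  have capF: "F v u \<le> cap x v u * pmf \<alpha> v" if v: "v \<in> N z - {x}" and u: "u \<in> N x \<inter> N v" for v u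
  proof (cases "v = c")
    case True
    have "u \<noteq> c"
      using u True nbr_ne by auto
    then have "F v u = ?s * (if u = a then k else 1 - k)" "(if u = a then k else 1 - k) \<le> cap x v u"
      using u True Nx ka kb by (auto simp: F_def)
    then show ?thesis
      using True mult_left_mono[of "if u = a then k else 1 - k" "cap x v u" ?s] by (simp add: mult.commute)
  next
    case False
    have "h u \<le> cap x v u"
    proof (cases "u = c")
      case True
      \<comment> \<open>Here \<open>v\<close> is adjacent to \<open>c\<close> and puts
        \<open>c\<close> under the bound 1/3. Hence \<open>h c \<le> 1 / 2\<close>, which
        \<open>cap x v c\<close> permits.\<close>
      have vx: "v \<notin> N x"
        using v False C by auto
      have vc: "v \<in> N c"
        using u True sym by auto
      then have "cap z x c = 1 / 3"
        using v vx by (intro cap_third[of v]) auto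
      then have "h c \<le> 1 / 2"
        unfolding hc using scap by (simp add: field_simps)
      moreover have "N c = {z, x, v}"
        using vc c v zx nbr_ne[of v z] by (intro nbr_eq) (auto simp: sym)
      then have "1 / 2 \<le> cap x v c"
        using v irrefl[of x] sym by (intro cap_half) auto
      ultimately show ?thesis
        using True by simp
    next
      case False
      then have "h u \<le> 1 / 3"
        using u Nx hab by auto
      then show ?thesis
        using cap_bounds(1)[of x v u] by simp
    qed
    then show ?thesis
      using False mult_left_mono[of "h u" "cap x v u" "pmf \<alpha> v"] by (simp add: F_def mult.commute)
  qed
  have row: "(\<Sum>u\<in>N x. F v u) = pmf \<alpha> v" for v
  proof (cases "v = c")
    case True
    then show ?thesis
      using Nx by (auto simp: F_def algebra_simps)
  next
    case False
    then have "(\<Sum>u\<in>N x. F v u) = (\<Sum>u\<in>N x. pmf \<alpha> v * h u)"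
      by (simp add: F_def)
    also have "\<dots> = pmf \<alpha> v * (h c + h a + h b)"
      using Nx by (simp add: sum_distrib_left[symmetric])
    finally show ?thesis
      using hsum by simp
  qed
  have "0 \<le> F v u" for v u
    using k h0 by (auto simp: F_def)
  then have "flow z x \<alpha> F"
    unfolding flow_def using col capF row C by (auto simp: F_def)
  then show ?thesis
    by blast
qed

lemma nbr_obtain:
  assumes "c \<in> N x"
  obtains a b where "N x = {c, a, b}" "distinct [c, a, b]"
proof -
  have "x \<in> V"
    using assms sym nbr_V by blast
  then have "card (N x - {c}) = 2"
    using assms by (simp add: card_nbr finite_nbr)
  then obtain a b where "N x - {c} = {a, b}" "a \<noteq> b"
    by (auto simp: card_2_iff)
  then have "N x = {c, a, b}" "distinct [c, a, b]"
    using assms by auto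
  then show thesis
    by (rule that)
qed

lemma nbr_obtain_third:
  assumes "c \<in> N x" "d \<in> N x" "c \<noteq> d"
  obtains v where "N x = {c, d, v}" "v \<noteq> c" "v \<noteq> d"
proof -
  obtain a b where ab: "N x = {c, a, b}" "distinct [c, a, b]"
    using assms(1) by (rule nbr_obtain)
  show thesis
  proof (cases "d = a")
    case True
    with ab show thesis
      by (intro that[of b]) auto
  next
    case False
    with ab assms show thesis
      by (intro that[of a]) auto
  qed
qed

text \<open>The vertex \<open>b\<close> lowers \<open>cap x c a\<close> to 1/3, which forces
  \<open>k = 1 / 3\<close>. The column of \<open>b\<close> then requires
  \<open>pmf \<alpha> c \<le> 1 / 2\<close>, and this holds because \<open>z\<close> and
  \<open>x\<close> are not adjacent.\<close>

lemma flow_one_common_diamond: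
  assumes g: "good z x \<alpha>" and C: "N z \<inter> N x = {c}" and Nx: "N x = {c, a, b}" "distinct [c, a, b]"
    and D: "a \<in> N c" "b \<in> N a" "b \<notin> N c"
  shows "\<exists>F. flow z x \<alpha> F"
proof -
  have c: "c \<in> N z" "c \<in> N x"
    using C by auto
  have "z \<noteq> c"
    using c irrefl by auto
  \<comment> \<open>\<open>z = a\<close> would make \<open>b\<close> a second common neighbour of
    \<open>z\<close> and \<open>x\<close>.\<close>
  moreover have "z \<noteq> a"
    using C D Nx by auto
  moreover have "z \<noteq> b"
    using c D sym by auto
  ultimately have "z \<notin> N x"
    using Nx by simp
  then have "pmf \<alpha> c \<le> 1 / 2"
    using good_cap[OF g c] cap_bounds(3)[of z x c] by simp
  then show ?thesis
    using D cap_bounds(1)[of x c a] by (intro flow_one_common_aux[OF g C Nx, of "1 / 3"]) auto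
qed

text \<open>The even split \<open>k = 1 / 2\<close> needs only the general bound 2/3 on
  \<open>pmf \<alpha> c\<close>. It can fail when \<open>a\<close> or \<open>b\<close> is adjacent
  to both other neighbours of \<open>x\<close>, which is the diamond case.\<close>

lemma flow_one_common:
  assumes g: "good z x \<alpha>" and C: "N z \<inter> N x = {c}"
  shows "\<exists>F. flow z x \<alpha> F"
proof -
  have c: "c \<in> N z" "c \<in> N x"
    using C by auto
  obtain a b where Nx: "N x = {c, a, b}" "distinct [c, a, b]"
    using c(2) by (rule nbr_obtain)
  have "pmf \<alpha> c \<le> cap z x c"
    using good_cap[OF g c] .
  then have s: "pmf \<alpha> c \<le> 2 / 3"
    using cap_bounds(2)[of z x c] by simp
  have no_K4: "\<not> (a \<in> N c \<and> b \<in> N a \<and> b \<in> N c)"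
  proof
    assume *: "a \<in> N c \<and> b \<in> N a \<and> b \<in> N c"
    then have "K4_at x"
      using Nx sym by (auto simp: K4_at_def)
    have ax: "a \<in> N x" "b \<in> N x"
      using Nx by auto
    \<comment> \<open>So \<open>z\<close>, a neighbour of \<open>c\<close> other than
      \<open>x\<close>, is \<open>a\<close> or \<open>b\<close> and hence adjacent to
      \<open>x\<close>.\<close>
    have "N c = {x, a, b}"
      using * c Nx ax nbr_ne sym by (intro nbr_eq) auto
    then have "z \<in> N x"
      using c g ax sym by (auto simp: good_def)
    with \<open>K4_at x\<close> g show False
      by (simp add: good_def)
  qed
  consider "a \<in> N c" "b \<in> N a" | "b \<in> N c" "a \<in> N b" | "b \<in> N a \<longrightarrow> a \<notin> N c \<and> b \<notin> N c"
    using sym by blast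
  then show ?thesis
  proof cases
    case 1
    then show ?thesis
      using no_K4 by (intro flow_one_common_diamond[OF g C Nx]) auto
  next
    case 2
    then show ?thesis
      using no_K4 Nx sym by (intro flow_one_common_diamond[OF g C, of b a]) auto
  next
    case 3
    \<comment> \<open>In this case \<open>a\<close> is not adjacent to \<open>b\<close>, so
      \<open>c\<close> is its only neighbour within \<open>N x\<close>.\<close>
    have "1 / 2 \<le> cap x c a" if "a \<in> N c"
      using 3 that Nx irrefl by (intro cap_half) auto
    moreover have "1 / 2 \<le> cap x c b" if "b \<in> N c"
      using 3 that Nx irrefl sym by (intro cap_half) auto
    ultimately show ?thesis
      using s by (intro flow_one_common_aux[OF g C Nx, of "1 / 2"]) auto
  qed
qed

text \<open>Both caps are 1/2, so \<open>\<alpha>\<close> is the fair choice between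
  \<open>c\<close> and \<open>d\<close>, and the zero diagonal with the column sums determines the
  flow. As \<open>c\<close> and \<open>d\<close> are not adjacent, only the moves to
  \<open>z\<close> are capped.\<close>

lemma flow_two_common_adjacent:
  assumes g: "good z x \<alpha>" and C: "N z \<inter> N x = {c, d}" "c \<noteq> d" and zx: "z \<in> N x"
  shows "\<exists>F. flow z x \<alpha> F"
proof -
  have cd: "c \<in> N z" "c \<in> N x" "d \<in> N z" "d \<in> N x"
    using C by auto
  have ne: "c \<noteq> z" "c \<noteq> x" "d \<noteq> z" "d \<noteq> x"
    using cd nbr_ne by auto
  have Nz: "N z = {x, c, d}"
    using cd ne C zx sym by (intro nbr_eq) auto
  have Nx: "N x = {z, c, d}"
    using cd ne C zx by (intro nbr_eq) auto
  have S: "N z - {x} = {c, d}"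
    using Nz ne by auto
  have "c \<notin> N d"
  proof
    assume "c \<in> N d"
    then have "K4_at x"
      unfolding K4_at_def Nx using cd sym by auto
    with g zx show False
      by (simp add: good_def)
  qed
  then have ncd: "c \<notin> N d" "d \<notin> N c"
    using sym by auto
  have cap: "cap z x e = 1 / 2" for e
    unfolding cap_def S using cd by auto
  have "pmf \<alpha> c \<le> 1 / 2" "pmf \<alpha> d \<le> 1 / 2"
    using good_cap[OF g, unfolded cap] cd by auto
  moreover have "pmf \<alpha> c + pmf \<alpha> d = 1"
    using good_sum[OF g] C by (simp add: S)
  ultimately have half: "pmf \<alpha> c = 1 / 2" "pmf \<alpha> d = 1 / 2"
    by auto
  have "1 / 6 \<le> cap x y z * pmf \<alpha> y" if "y \<in> {c, d}" for y
  proof -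
    have "pmf \<alpha> y = 1 / 2"
      using that half by auto
    then show ?thesis
      unfolding \<open>pmf \<alpha> y = 1 / 2\<close> using cap_bounds(1)[of x y z] by simp
  qed
  then have "flow z x \<alpha> (\<lambda>v u. if u = v then 0 else if u = z then 1 / 6 else 1 / 3)"
    unfolding flow_def S Nx using C(2) ne ncd half irrefl by auto
  then show ?thesis
    by blast
qed

text \<open>Every row sends a third of its mass to \<open>w\<close>; \<open>c\<close> and
  \<open>d\<close> send the rest to each other, and the row of \<open>v\<close> fills up the
  columns. It is nonnegative because \<open>c\<close> and \<open>d\<close> carry at most 1/2
  each.\<close>

lemma flow_two_common_nonadjacent:
  assumes g: "good z x \<alpha>" and C: "N z \<inter> N x = {c, d}" "c \<noteq> d" and zx: "z \<notin> N x"
  shows "\<exists>F. flow z x \<alpha> F"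
proof -
  let ?p = "pmf \<alpha>"
  have cd: "c \<in> N z" "c \<in> N x" "d \<in> N z" "d \<in> N x"
    using C by auto
  obtain v where Nz: "N z = {c, d, v}" "v \<noteq> c" "v \<noteq> d"
    using cd(1,3) C(2) by (rule nbr_obtain_third)
  obtain w where Nx: "N x = {c, d, w}" "w \<noteq> c" "w \<noteq> d"
    using cd(2,4) C(2) by (rule nbr_obtain_third)
  have vw: "v \<notin> N x" "w \<notin> N z" "v \<noteq> w"
    using C Nx Nz by auto
  have S: "N z - {x} = {c, d, v}"
    using Nz zx sym by auto
  have zx': "z \<noteq> x" "x \<notin> N z"
    using g zx sym by (auto simp: good_def)
  have half: "?p c \<le> 1 / 2" "?p d \<le> 1 / 2"
    using order_trans[OF good_cap[OF g] cap_bounds(3)[OF zx]] cd by auto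
  have sum: "?p c + ?p d + ?p v = 1"
    using good_sum[OF g, unfolded S] C(2) Nz(2,3) by auto
  have third: "?p e \<le> 1 / 3" if "e \<in> {c, d}" "v \<in> N e" for e
  proof -
    have "v \<in> N z" "v \<noteq> x"
      using Nz zx' by auto
    then have "cap z x e = 1 / 3"
      using that vw by (intro cap_third[of v]) auto
    then show ?thesis
      using good_cap[OF g, of e] that cd by auto
  qed
  \<comment> \<open>The value 2/3 of \<open>cap\<close> serves this configuration: \<open>w\<close>
    is adjacent to neither \<open>e\<close> nor \<open>e'\<close>, while \<open>x\<close> is
    adjacent to \<open>e\<close>, which rules out the smaller values.\<close>
  have cap_cd: "2 / 3 \<le> cap x e e'" if "e \<in> {c, d}" "e' \<in> {c, d}" "e' \<in> N e" for e e'
  proof -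
    have e: "e \<noteq> e'" "e \<in> N e'" "e \<in> N z" "e \<in> N x" "e' \<in> N z" "e' \<in> N x"
      using that nbr_ne sym cd by auto
    then have "e \<noteq> z" "e' \<noteq> z" "e \<noteq> x" "e' \<noteq> x"
      using nbr_ne by auto
    then have "N e = {z, x, e'}" "N e' = {z, x, e}"
      using nbr_eq'[of z x e' e] nbr_eq'[of z x e e'] that e zx'(1) by auto
    moreover have "w \<noteq> z" "w \<noteq> x" "w \<noteq> e" "w \<noteq> e'"
      using Nx zx that irrefl[of x] by auto
    ultimately have "w \<notin> N e" "w \<notin> N e'"
      by auto
    moreover have "N x - {e} = {e', w}"
      using that e Nx by auto
    moreover have "x \<in> N e"
      using e sym by auto
    ultimately show ?thesis
      using that irrefl[of e'] by (auto simp: cap_def)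
  qed
  have cap_v: "1 / 2 \<le> cap x v e" if "e \<in> {c, d}" "e \<in> N v" for e
  proof -
    have e: "e \<in> N z" "e \<in> N x"
      using that cd by auto
    have "x \<noteq> v"
      using Nz zx' by auto
    moreover have "z \<noteq> v"
      using Nz irrefl[of z] by auto
    ultimately have "N e = {z, x, v}"
      using that e zx' by (intro nbr_eq') auto
    then show ?thesis
      using zx irrefl[of x] irrefl[of v] by (intro cap_half) auto
  qed
  define F where "F y u = (if u = w then ?p y / 3 else if y = c then (if u = d then 2 / 3 * ?p c else 0)
      else if y = d then (if u = c then 2 / 3 * ?p d else 0)
      else if u = c then 1 / 3 - 2 / 3 * ?p d else 1 / 3 - 2 / 3 * ?p c)" for y u
  have le_w: "?p y / 3 \<le> cap x y w * ?p y" for y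
    using mult_right_mono[OF cap_bounds(1), of "?p y" x y w] by simp
  have capcd: "2 / 3 * ?p c \<le> cap x c d * ?p c" if "d \<in> N c"
    using that by (intro mult_right_mono cap_cd) auto
  have capdc: "2 / 3 * ?p d \<le> cap x d c * ?p d" if "c \<in> N d"
    using that by (intro mult_right_mono cap_cd) auto
  have capvc: "1 / 3 - 2 / 3 * ?p d \<le> cap x v c * ?p v" if "c \<in> N v"
  proof -
    \<comment> \<open>Adjacency to \<open>v\<close> puts \<open>c\<close> under the bound 1/3, which
      leaves enough mass on \<open>v\<close>: at least \<open>2 / 3 - ?p d\<close>.\<close>
    have "?p c \<le> 1 / 3"
      using third[of c] that sym by auto
    then have "1 / 3 - 2 / 3 * ?p d \<le> 1 / 2 * ?p v"
      using sum pmf_nonneg[of \<alpha> d] by linarith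
    also have "\<dots> \<le> cap x v c * ?p v"
      using that by (intro mult_right_mono cap_v) auto
    finally show ?thesis .
  qed
  have capvd: "1 / 3 - 2 / 3 * ?p c \<le> cap x v d * ?p v" if "d \<in> N v"
  proof -
    have "?p d \<le> 1 / 3"
      using third[of d] that sym by auto
    then have "1 / 3 - 2 / 3 * ?p c \<le> 1 / 2 * ?p v"
      using sum pmf_nonneg[of \<alpha> c] by linarith
    also have "\<dots> \<le> cap x v d * ?p v"
      using that by (intro mult_right_mono cap_v) auto
    finally show ?thesis .
  qed
  have cap: "F y u \<le> cap x y u * ?p y" if yu: "y \<in> {c, d, v}" "u \<in> N x" "u \<in> N y" for y u
  proof (cases "u = w")
    case True
    then show ?thesis
      using le_w by (simp add: F_def)
  next
    case False
    then have u: "u = c \<or> u = d" and ne: "y \<noteq> u"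
      using yu Nx(1) irrefl by auto
    consider "y = c" | "y = d" | "y = v"
      using yu(1) by blast
    then show ?thesis
    proof cases
      case 1
      then show ?thesis
        using u ne capcd yu(3) False by (auto simp: F_def)
    next
      case 2
      then show ?thesis
        using u ne capdc yu(3) False C(2) by (auto simp: F_def)
    next
      case 3
      then show ?thesis
        using u capvc capvd yu(3) False Nz(2,3) C(2) by (auto simp: F_def)
    qed
  qed
  have "flow z x \<alpha> F"
    unfolding flow_def S
  proof (intro conjI ballI)
    show "F y u \<le> cap x y u * ?p y" if "y \<in> {c, d, v}" "u \<in> N x \<inter> N y" for y u
      using cap that by auto
    show "0 \<le> F y u" for y u
      using half by (auto simp: F_def)
    show "(\<Sum>u\<in>N x. F y u) = ?p y" if y: "y \<in> {c, d, v}" for y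
    proof -
      have "(\<Sum>u\<in>N x. F y u) = F y c + F y d + F y w"
        using C(2) Nx by auto
      consider "y = c" | "y = d" "y \<noteq> c" | "y = v" "y \<noteq> c" "y \<noteq> d"
        using y by blast
      then show ?thesis
        unfolding \<open>(\<Sum>u\<in>N x. F y u) = F y c + F y d + F y w\<close>
        using sum C(2) Nx(2,3) by cases (auto simp: F_def)
    qed
    show "(\<Sum>y\<in>{c, d, v}. F y u) = 1 / 3" if u: "u \<in> N x" for u
    proof -
      have "(\<Sum>y\<in>{c, d, v}. F y u) = F c u + F d u + F v u"
        using C(2) Nz(2,3) by auto
      consider "u = w" | "u = c" "u \<noteq> w" | "u = d" "u \<noteq> w" "u \<noteq> c"
        using u Nx(1) by blast
      then show ?thesis
        unfolding \<open>(\<Sum>y\<in>{c, d, v}. F y u) = F c u + F d u + F v u\<close>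
        using sum C(2) Nz(2,3) by cases (auto simp: F_def)
    qed
    show "F y y = 0" if "y \<in> {c, d, v} \<inter> N x" for y
      using that vw C(2) Nx(2,3) by (auto simp: F_def)
  qed
  then show ?thesis
    by blast
qed

text \<open>\<open>no_H3t\<close> makes the three common neighbours pairwise nonadjacent, so no move
  is capped and only the diagonal has to be avoided.\<close>

lemma flow_three_common:
  assumes g: "good z x \<alpha>" and C: "N z \<inter> N x = {c, d, e}" "distinct [c, d, e]"
  shows "\<exists>F. flow z x \<alpha> F"
proof -
  let ?p = "pmf \<alpha>"
  have "c \<in> N z" "d \<in> N z" "e \<in> N z"
    using C(1) by blast+
  with C(2) have Nz: "N z = {c, d, e}"
    by (rule nbr_eq)
  have "c \<in> N x" "d \<in> N x" "e \<in> N x"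
    using C(1) by blast+
  with C(2) have Nx: "N x = {c, d, e}"
    by (rule nbr_eq)
  have zx: "z \<notin> N x" "x \<notin> N z" "z \<noteq> x"
    using Nz Nx irrefl[of z] irrefl[of x] g by (simp_all add: good_def)
  have S: "N z - {x} = {c, d, e}"
    using Nz zx by auto
  have le: "?p y \<le> 1 / 2" if "y \<in> {c, d, e}" for y
    using order_trans[OF good_cap[OF g] cap_bounds(3)[OF zx(1)]] that C by auto
  have sum: "?p c + ?p d + ?p e = 1"
    using good_sum[OF g, unfolded S] C(2) by auto
  have "d \<notin> N c" "e \<notin> N d" "e \<notin> N c"
    using no_H3t[OF zx(3), of c d e] no_H3t[OF zx(3), of d e c] no_H3t[OF zx(3), of c e d] C by auto
  then have nonadj: "u \<notin> N y" if "y \<in> {c, d, e}" "u \<in> {c, d, e}" for y u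
    using that irrefl sym by auto
  have ge: "?p c + ?p d \<ge> 1 / 2" "?p c + ?p e \<ge> 1 / 2" "?p d + ?p e \<ge> 1 / 2"
    using le[of c] le[of d] le[of e] sum by auto
  \<comment> \<open>Matrices with zero diagonal and these row and column sums form a one-parameter
    family. This member is affine in the weights and nonnegative once any two weights sum to at
    least 1/2.\<close>
  have "flow z x \<alpha> (\<lambda>y u. if y = u then 0 else 2 / 3 * ?p y + 1 / 3 * ?p u - 1 / 6)"
    unfolding flow_def S Nx
  proof (intro conjI ballI)
    fix y u assume yu: "y \<in> {c, d, e}" "u \<in> {c, d, e}"
    show "0 \<le> (if y = u then 0 else 2 / 3 * ?p y + 1 / 3 * ?p u - 1 / 6)"
    proof (cases "y = u")
      case False
      then have "?p y + ?p u \<ge> 1 / 2"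
        using yu ge by (auto simp: add.commute)
      then have "0 \<le> 2 / 3 * ?p y + 1 / 3 * ?p u - 1 / 6"
        using pmf_nonneg[of \<alpha> y] by linarith
      then show ?thesis
        using False by simp
    qed simp
  next
    fix y assume "y \<in> {c, d, e}"
    then show "(\<Sum>u\<in>{c, d, e}. if y = u then 0 else 2 / 3 * ?p y + 1 / 3 * ?p u - 1 / 6) = ?p y"
      using C(2) sum by (auto simp: field_simps)
  next
    fix u assume "u \<in> {c, d, e}"
    then show "(\<Sum>y\<in>{c, d, e}. if y = u then 0 else 2 / 3 * ?p y + 1 / 3 * ?p u - 1 / 6) = 1 / 3"
      using C(2) sum by (auto simp: field_simps)
  qed (use nonadj in auto)
  then show ?thesis
    by blast
qed

section \<open>Preservation and existence of the invariant\<close>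

lemma good_step:
  assumes g: "good z x \<alpha>"
  shows "\<exists>f. bind_pmf \<alpha> f = pmf_of_set (N x) \<and> (\<forall>v\<in>set_pmf \<alpha>. good x v (f v))"
proof -
  let ?C = "N z \<inter> N x"
  have "z \<in> V"
    using g by (simp add: good_def)
  then have "card ?C \<le> 3"
    using card_mono[OF finite_nbr, of ?C z] by (simp add: card_nbr)
  then consider "card ?C = 0" | "card ?C = 1" | "card ?C = 2" | "card ?C = 3"
    by linarith
  then have "\<exists>F. flow z x \<alpha> F"
  proof cases
    case 1
    then show ?thesis
      using flow_disjoint[OF g] finite_nbr by auto
  next
    case 2
    then show ?thesis
      using flow_one_common[OF g] by (auto simp: card_1_singleton_iff)
  next
    case 3
    then obtain c d where "?C = {c, d}" "c \<noteq> d"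
      by (auto simp: card_2_iff)
    then show ?thesis
      using flow_two_common_adjacent[OF g] flow_two_common_nonadjacent[OF g] by (cases "z \<in> N x") auto
  next
    case 4
    then obtain c d e where "?C = {c, d, e}" "distinct [c, d, e]"
      by (auto simp: card_3_iff)
    then show ?thesis
      by (rule flow_three_common[OF g])
  qed
  then obtain F where "flow z x \<alpha> F" ..
  with g obtain f where "bind_pmf \<alpha> f = pmf_of_set (N x)" "\<And>v. v \<in> set_pmf \<alpha> \<Longrightarrow> good x v (f v)"
    by (rule flow_step) blast
  then show ?thesis
    by blast
qed

text \<open>The closed neighbourhood of \<open>z\<close> has four vertices, so some \<open>x\<close>
  lies outside it. Then the \<open>K4_at\<close> clause is vacuous, and uniform weights 1/3 respect
  every cap.\<close>

lemma good_exists: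
  assumes "5 \<le> card V"
  obtains z x \<alpha> where "good z x \<alpha>"
proof -
  obtain z where z: "z \<in> V"
    using assms by fastforce
  have "card (insert z (N z)) = 4"
    using z by (simp add: finite_nbr irrefl card_nbr)
  then have "insert z (N z) \<noteq> V"
    using assms by auto
  then obtain x where x: "x \<in> V" "x \<noteq> z" "x \<notin> N z"
    using z nbr_V by blast
  have Nz: "N z \<noteq> {}"
    using z card_nbr by fastforce
  have "1 / real (card (N z)) \<le> cap z x c" for c
    using cap_bounds(1)[of z x c] z by (simp add: card_nbr)
  then have "good z x (pmf_of_set (N z))"
    using z x Nz sym by (auto simp: good_def finite_nbr)
  then show thesis
    by (rule that)
qed

end

section \<open>Cubic graphs that avoid the excluded subgraph\<close>

lemma contains_H3t:
  assumes G: "simple_graph V E" and ab: "a \<noteq> b" and c: "distinct [c, c', c'']"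
    and N: "{c, c', c''} \<subseteq> nbrs V E a \<inter> nbrs V E b" and "c' \<in> nbrs V E c"
  shows "contains_subgraph V E H3t_verts H3t_edges"
proof -
  define f where "f h = (case h of vA \<Rightarrow> a | vB \<Rightarrow> b | vC i \<Rightarrow> if i = 1 then c else if i = 2 then c' else c'')" for h
  have f: "f vA = a" "f vB = b" "f (vC 1) = c" "f (vC 2) = c'" "f (vC 3) = c''"
    by (simp_all add: f_def)
  have edge: "{a, c} \<in> E" "{a, c'} \<in> E" "{a, c''} \<in> E" "{b, c} \<in> E" "{b, c'} \<in> E" "{b, c''} \<in> E" "{c, c'} \<in> E"
    using assms by (auto simp: nbrs_def insert_commute)
  have edge_subset: "e \<subseteq> V" if "e \<in> E" for e
    using G that by (simp add: simple_graph_def)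
  have V: "a \<in> V" "b \<in> V" "c \<in> V" "c' \<in> V" "c'' \<in> V"
    using edge[THEN edge_subset] by auto
  \<comment> \<open>No vertex is its own neighbour, so the two sides are disjoint and
    \<open>f\<close> is injective.\<close>
  have "{a, b} \<inter> {c, c', c''} = {}"
    using N nbrs_irrefl[OF G, of a] nbrs_irrefl[OF G, of b] by blast
  then have "inj_on f H3t_verts"
    using ab c by (auto simp: inj_on_def H3t_verts_def f simp del: One_nat_def)
  moreover have "f ` H3t_verts \<subseteq> V"
    using V by (simp add: H3t_verts_def f del: One_nat_def)
  moreover have "\<forall>e\<in>H3t_edges. f ` e \<in> E"
    using edge by (simp add: H3t_edges_def f del: One_nat_def)
  ultimately show ?thesis
    unfolding contains_subgraph_def by blast
qed

theorem has_avoidance_coupling_cubic: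
  assumes G: "simple_graph V E" and reg: "regular 3 V E" and V: "5 \<le> card V"
    and H: "\<not> contains_subgraph V E H3t_verts H3t_edges"
  shows "has_avoidance_coupling V E"
proof -
  have fin: "finite V"
    using G by (simp add: simple_graph_def)
  interpret cubic V "nbrs V E"
  proof
    show "card (nbrs V E v) = 3" if "v \<in> V" for v
      using reg that by (simp add: regular_def deg_def)
    show "c' \<notin> nbrs V E c"
      if "a \<noteq> b" "distinct [c, c', c'']" "{c, c', c''} \<subseteq> nbrs V E a \<inter> nbrs V E b" for a b c c' c''
      using contains_H3t[OF G that] H by blast
  qed (fact fin nbrs_subset nbrs_sym[OF G] nbrs_irrefl[OF G])+
  show ?thesis
  \<comment> \<open>The vertex \<open>z\<close> that the other walker has left is not part of the
    state; it only has to exist.\<close>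
  proof (rule has_avoidance_coupling_alternating[where G = "{(x, \<alpha>) |x \<alpha>. \<exists>z. good z x \<alpha>}"])
    show "nbrs V E v \<noteq> {}" if "v \<in> V" for v
      using card_nbr[OF that] by auto
    show "{(x, \<alpha>) |x \<alpha>. \<exists>z. good z x \<alpha>} \<noteq> {}"
    proof -
      obtain z x \<alpha> where "good z x \<alpha>"
        using V by (rule good_exists)
      then show ?thesis
        by auto
    qed
    fix x \<alpha> assume "(x, \<alpha>) \<in> {(x, \<alpha>) |x \<alpha>. \<exists>z. good z x \<alpha>}"
    then obtain z where g: "good z x \<alpha>"
      by auto
    obtain f where f: "bind_pmf \<alpha> f = pmf_of_set (nbrs V E x)" "\<And>v. v \<in> set_pmf \<alpha> \<Longrightarrow> good x v (f v)"
      using good_step[OF g] by blast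
    \<comment> \<open>The next hidden law is a function of the revealed vertex \<open>v\<close>, and
      \<open>x\<close> takes over the role of \<open>z\<close>.\<close>
    let ?Q = "map_pmf (\<lambda>v. (v, f v)) \<alpha>"
    have "map_pmf fst ?Q = \<alpha>"
      by (simp add: map_pmf_comp)
    moreover have "bind_pmf ?Q snd = pmf_of_set (nbrs V E x)"
      using f(1) by (simp add: bind_map_pmf)
    moreover have "set_pmf ?Q \<subseteq> {(x, \<alpha>) |x \<alpha>. \<exists>z. good z x \<alpha>}"
      using f(2) by auto
    moreover have "x \<in> V \<and> x \<notin> set_pmf \<alpha>"
      using g by (auto simp: good_def)
    ultimately show "x \<in> V \<and> x \<notin> set_pmf \<alpha> \<and>
        (\<exists>Q. map_pmf fst Q = \<alpha> \<and> bind_pmf Q snd = pmf_of_set (nbrs V E x) \<and>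
          set_pmf Q \<subseteq> {(x, \<alpha>) |x \<alpha>. \<exists>z. good z x \<alpha>})"
      by blast
  qed (rule fin)
qed

theorem theorem1p1:
  fixes V :: "'a set" and E :: "'a set set" and d n :: nat
  assumes "simple_graph V E" and "regular d V E" and "card V = n" and "n \<ge> 5"
  shows "(d \<ge> 4 \<and> \<not> contains_subgraph V E (H_verts d) (H_edges d) \<longrightarrow>
            has_avoidance_coupling V E) \<and>
         (d = 3 \<and> \<not> contains_subgraph V E H3t_verts H3t_edges \<longrightarrow>
            has_avoidance_coupling V E)"
proof -
  have "has_avoidance_coupling V E" if "d \<ge> 4"
    using assms that by (intro has_avoidance_coupling_min_degree_4) (auto simp: regular_def)
  moreover have "has_avoidance_coupling V E" if "d = 3" "\<not> contains_subgraph V E H3t_verts H3t_edges"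
    using assms that by (intro has_avoidance_coupling_cubic) auto
  ultimately show ?thesis
    by blast
qed

end
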